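(* (1) The super-Apollonian group $\mathcal A^S$ is a normal subgroup of index $48$ in $\mathrm{Aut}(Q_D,\mathbb Z)$, and $\mathrm{Aut}(Q_D,\mathbb Z)$ is generated by $\mathcal A^S$ together with the finite group of order $48$ generated by the $4\times4$ permutation matrices and $\pm I$. (2) $\mathcal A^S$ is a normal subgroup of index $96$ in $G=J_0\,O(3,1;\mathbb Z)\,J_0^{-1}$, where $J_0=\frac12\begin{pmatrix}1&1&1&1\\1&1&-1&-1\\1&-1&1&-1\\1&-1&-1&1\end{pmatrix}$. The group $G$ is generated by $\mathrm{Aut}(Q_D,\mathbb Z)$ and the matrix $D=\frac12\begin{pmatrix}-1&1&1&1\\1&-1&1&1\\1&1&-1&1\\1&1&1&-1\end{pmatrix}$, and every matrix in $G$ has all entries in $\frac12\mathbb Z$.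
   Context: Let $S_i$ ($i=1,\dots,4$) be the $4\times4$ integer matrix equal to the identity except that row $i$ has $-1$ in position $i$ and $2$ in the other three positions, and $S_i^\perp=S_i^T$. The super-Apollonian group is $\mathcal A^S=\langle S_1,\dots,S_4,S_1^\perp,\dots,S_4^\perp\rangle$. Let $Q_D=I-\frac12\mathbf 1\mathbf 1^T$ (the matrix of the Descartes quadratic form $\sum x_i^2-\frac12(\sum x_i)^2$) and $\mathrm{Aut}(Q_D,\mathbb Z)=\{U\in M_4(\mathbb Z): U^TQ_DU=Q_D\}$. Let $Q_L=\mathrm{diag}(-1,1,1,1)$ and $O(3,1;\mathbb Z)=\{U\in M_4(\mathbb Z):U^TQ_LU=Q_L\}$. *)

theory Defs
  imports "HOL-Analysis.Analysis" "HOL-Algebra.Generated_Groups" "HOL-Algebra.Coset"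
begin

type_synonym mat4 = "real^4^4"

text \<open>Indices of 4x4 matrices are the elements 1,2,3,4 of the numeral type 4;
  the library function vector builds a vector from a list, list position k
  going to index k+1.\<close>

definition int_mat :: "mat4 \<Rightarrow> bool" where
  "int_mat M \<longleftrightarrow> (\<forall>i j. M$i$j \<in> \<int>)"

text \<open>S_i: identity except row i, which has -1 at position i and 2 elsewhere.\<close>
definition S_mat :: "4 \<Rightarrow> mat4" where
  "S_mat i = (\<chi> r c. if r = i then (if c = i then -1 else 2) else (if r = c then 1 else 0))"

definition Q_D :: mat4 where
  "Q_D = mat 1 - (\<chi> i j. 1/2)"

definition Q_L :: mat4 where
  "Q_L = vector [vector [-1,0,0,0], vector [0,1,0,0], vector [0,0,1,0], vector [0,0,0,1]]"

definition Aut_QD :: "mat4 set" where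
  "Aut_QD = {U. int_mat U \<and> transpose U ** Q_D ** U = Q_D}"

definition O31Z :: "mat4 set" where
  "O31Z = {U. int_mat U \<and> transpose U ** Q_L ** U = Q_L}"

definition J0 :: mat4 where
  "J0 = (1/2) *\<^sub>R vector [vector [1,1,1,1], vector [1,1,-1,-1], vector [1,-1,1,-1], vector [1,-1,-1,1]]"

definition D_mat :: mat4 where
  "D_mat = (1/2) *\<^sub>R vector [vector [-1,1,1,1], vector [1,-1,1,1], vector [1,1,-1,1], vector [1,1,1,-1]]"

text \<open>The group G = J0 O(3,1;Z) J0^{-1}.\<close>
definition G_grp :: "mat4 set" where
  "G_grp = {J0 ** U ** matrix_inv J0 | U. U \<in> O31Z}"

text \<open>The general linear group GL_4(R) as a HOL-Algebra monoid, and matrix monoids on a carrier.\<close>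
definition mat_group :: "mat4 set \<Rightarrow> mat4 monoid" where
  "mat_group S = \<lparr>carrier = S, mult = (**), one = mat 1\<rparr>"

definition GL4 :: "mat4 monoid" where
  "GL4 = mat_group {M. invertible M}"

text \<open>Subgroup of GL_4(R) generated by a set of matrices.\<close>
definition mgen :: "mat4 set \<Rightarrow> mat4 set" where
  "mgen A = generate GL4 A"

definition perm_mats :: "mat4 set" where
  "perm_mats = {(\<chi> i j. if p i = j then 1 else 0) | p. p permutes (UNIV :: 4 set)}"

text \<open>The super-Apollonian group.\<close>
definition super_apollonian :: "mat4 set" where
  "super_apollonian = mgen (range S_mat \<union> (transpose ` range S_mat))"

text \<open>Finite group generated by the permutation matrices and -I.\<close>
definition perm_sign_group :: "mat4 set" where
  "perm_sign_group = mgen (perm_mats \<union> {- mat 1})"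

end

theory Submission
  imports Defs
begin

text \<open>Let \<open>U\<close> be an integral automorph of the Descartes form. Its row sums \<open>v\<close> are odd and satisfy
  \<open>2 (\<Sum> v k ^ 2) = s ^ 2 - 8\<close>, where \<open>s\<close> is the sum of all entries. Unless \<open>v\<close> is constantly
  \<open>1\<close> or \<open>-1\<close>, left multiplication by one of the eight generators decreases \<open>\<bar>s\<bar>\<close>; and if \<open>v\<close>
  is constant, then \<open>U\<close> is, up to sign, an orthogonal integer matrix with row sums \<open>1\<close>, that is, a
  permutation matrix. Hence \<open>Aut_QD\<close> is the product of the super-Apollonian group and the
  finite group of order 48. These meet trivially because modulo 4 every element of the
  super-Apollonian group has the form \<open>I + 2 (a i + b j)\<close>. Conjugation by permutation matrices and by
  \<open>D_mat = - Q_D\<close> permutes the generators, which gives normality. Finally a matrix in \<open>O31Z\<close> has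
  odd row and column sums, so all entries of its conjugate by \<open>J0\<close> are congruent modulo 1 to a quarter of the
  total sum, which is even; this sum becomes divisible by 4 after multiplication by
  \<open>J0 D_mat J0 = diag(1,-1,-1,-1)\<close> if it is not already, so \<open>Aut_QD\<close> has index 2 in \<open>G_grp\<close>.\<close>

section \<open>Abstract group theory\<close>

context group
begin

lemma conj_mult:
  assumes "x \<in> carrier G" "y \<in> carrier G" "z \<in> carrier G"
  shows "(x \<otimes> y) \<otimes> z \<otimes> inv (x \<otimes> y) = x \<otimes> (y \<otimes> z \<otimes> inv y) \<otimes> inv x"
  using assms by (simp add: inv_mult_group m_assoc)

text \<open>Conjugation by \<open>g\<close> is a homomorphism, so the hypothesis on generators
  spreads to inverses and products.\<close>

lemma conj_generate:
  assumes A: "A \<subseteq> carrier G" and g: "g \<in> carrier G"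
    and conj: "\<And>a. a \<in> A \<Longrightarrow> g \<otimes> a \<otimes> inv g \<in> generate G A"
    and x: "x \<in> generate G A"
  shows "g \<otimes> x \<otimes> inv g \<in> generate G A"
proof -
  have carr: "y \<in> carrier G" if "y \<in> generate G A" for y
    using generate_in_carrier[OF A that] .
  show ?thesis
    using x
  proof (induction rule: generate.induct)
    case one
    then show ?case using g by (simp add: generate.one)
  next
    case (incl h)
    then show ?case by (rule conj)
  next
    case (inv h)
    then have h: "h \<in> carrier G" using A by auto
    have "g \<otimes> inv h \<otimes> inv g = inv (g \<otimes> h \<otimes> inv g)"
      using g h by (simp add: inv_mult_group m_assoc)
    then show ?case
      using generate_m_inv_closed[OF A conj[OF inv]] by simp
  next
    case (eng a b)
    have "inv g \<otimes> (g \<otimes> (b \<otimes> inv g)) = b \<otimes> inv g"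
      using g carr[OF eng(2)] by (simp add: m_assoc[symmetric])
    then have "g \<otimes> (a \<otimes> b) \<otimes> inv g = (g \<otimes> a \<otimes> inv g) \<otimes> (g \<otimes> b \<otimes> inv g)"
      using g carr[OF eng(1)] carr[OF eng(2)] by (simp add: m_assoc)
    then show ?case using generate.eng[OF eng(3,4)] by simp
  qed
qed

text \<open>Conjugation by \<open>h \<otimes> f\<close> is conjugation by \<open>f\<close> followed
  by conjugation by \<open>h\<close>, and \<open>H\<close> is stable under the latter.\<close>

lemma normal_if_factor_normalizes:
  assumes H: "subgroup H G" and F: "F \<subseteq> carrier G"
    and fac: "\<And>x. x \<in> carrier G \<Longrightarrow> \<exists>h\<in>H. \<exists>f\<in>F. x = h \<otimes> f"
    and norm: "\<And>f y. f \<in> F \<Longrightarrow> y \<in> H \<Longrightarrow> f \<otimes> y \<otimes> inv f \<in> H"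
  shows "H \<lhd> G"
  unfolding normal_inv_iff
proof (intro conjI ballI H)
  fix x y assume "x \<in> carrier G" and y: "y \<in> H"
  then obtain h f where h: "h \<in> H" and f: "f \<in> F" and x: "x = h \<otimes> f" using fac by blast
  have carr: "h \<in> carrier G" "y \<in> carrier G" "f \<in> carrier G"
    using subgroup.mem_carrier[OF H h] subgroup.mem_carrier[OF H y] f F by auto
  show "x \<otimes> y \<otimes> inv x \<in> H"
    unfolding x conj_mult[OF carr(1,3,2)]
    using norm[OF f y] h H by (simp add: subgroup.m_closed subgroup.m_inv_closed)
qed

text \<open>\<open>fac\<close> makes \<open>f \<mapsto> H #> f\<close> surjective onto the right
  cosets and \<open>uniq\<close> makes it injective, so \<open>F\<close> is a transversal.\<close>

lemma card_rcosets_transversal: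
  assumes H: "subgroup H G" and F: "F \<subseteq> carrier G"
    and fac: "\<And>x. x \<in> carrier G \<Longrightarrow> \<exists>h\<in>H. \<exists>f\<in>F. x = h \<otimes> f"
    and uniq: "\<And>f g. f \<in> F \<Longrightarrow> g \<in> F \<Longrightarrow> f \<otimes> inv g \<in> H \<Longrightarrow> f = g"
  shows "card (rcosets H) = card F"
proof -
  have HG: "H \<subseteq> carrier G" using H by (rule subgroup.subset)
  have "bij_betw (\<lambda>f. H #> f) F (rcosets H)"
    unfolding bij_betw_def
  proof
    show "inj_on (\<lambda>f. H #> f) F"
    proof (rule inj_onI)
      fix f g assume f: "f \<in> F" and g: "g \<in> F" and eq: "H #> f = H #> g"
      have carr: "f \<in> carrier G" "g \<in> carrier G" using f g F by auto
      have "f \<in> H #> g" using rcos_self[OF carr(1) H] eq by simp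
      then obtain h where h: "h \<in> H" and "f = h \<otimes> g" unfolding r_coset_def by auto
      then have "f \<otimes> inv g = h" using carr HG by (auto simp: m_assoc)
      then show "f = g" using uniq[OF f g] h by simp
    qed
    show "(\<lambda>f. H #> f) ` F = rcosets H"
    proof
      show "(\<lambda>f. H #> f) ` F \<subseteq> rcosets H" using F HG by (auto intro: rcosetsI)
      show "rcosets H \<subseteq> (\<lambda>f. H #> f) ` F"
      proof
        fix C assume "C \<in> rcosets H"
        then obtain x where x: "x \<in> carrier G" and C: "C = H #> x" unfolding RCOSETS_def by auto
        then obtain h f where h: "h \<in> H" and f: "f \<in> F" and xf: "x = h \<otimes> f" using fac by blast
        have "H #> x = H #> f"
          using repr_independence[of x H f] h f F H xf HG by (auto simp: r_coset_def)
        then show "C \<in> (\<lambda>f. H #> f) ` F" using C f by auto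
      qed
    qed
  qed
  then show ?thesis by (simp add: bij_betw_same_card)
qed

end

section \<open>Matrix groups\<close>

lemma GL4_simps [simp]:
  "carrier GL4 = {M. invertible M}" "x \<otimes>\<^bsub>GL4\<^esub> y = x ** y" "\<one>\<^bsub>GL4\<^esub> = mat 1"
  by (simp_all add: GL4_def mat_group_def)

lemma group_GL4: "group GL4"
proof (rule groupI)
  fix x assume "x \<in> carrier GL4"
  then obtain y where "x ** y = mat 1" "y ** x = mat 1" by (auto simp: invertible_def)
  then show "\<exists>y\<in>carrier GL4. y \<otimes>\<^bsub>GL4\<^esub> x = \<one>\<^bsub>GL4\<^esub>"
    by (auto simp: invertible_def)
next
  have "invertible (mat 1 :: mat4)" unfolding invertible_def by auto
  then show "\<one>\<^bsub>GL4\<^esub> \<in> carrier GL4" by simp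
qed (auto simp: invertible_mult matrix_mul_assoc)

interpretation GL4: group GL4 by (rule group_GL4)

lemma inv_GL4:
  fixes M N :: mat4
  assumes "M ** N = mat 1"
  shows "inv\<^bsub>GL4\<^esub> M = N"
  using assms GL4.inv_equality[of N M] matrix_left_right_inverse[of M N]
  by (auto simp: invertible_def)

lemma mat_group_eq: "mat_group S = GL4\<lparr>carrier := S\<rparr>"
  by (simp add: GL4_def mat_group_def)

lemma mat_group_simps [simp]:
  "carrier (mat_group S) = S" "x \<otimes>\<^bsub>mat_group S\<^esub> y = x ** y" "\<one>\<^bsub>mat_group S\<^esub> = mat 1"
  by (simp_all add: mat_group_def)

lemma subgroup_mat_group:
  assumes "subgroup H GL4" "subgroup K GL4" "H \<subseteq> K"
  shows "subgroup H (mat_group K)"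
  unfolding mat_group_eq using GL4.subgroup_incl[OF assms] .

lemma inv_mat_group:
  assumes "subgroup K GL4" "x \<in> K"
  shows "inv\<^bsub>mat_group K\<^esub> x = inv\<^bsub>GL4\<^esub> x"
  unfolding mat_group_eq by (rule GL4.m_inv_consistent[OF assms])

lemma group_mat_group:
  assumes "subgroup K GL4"
  shows "group (mat_group K)"
  unfolding mat_group_eq by (rule GL4.subgroup_imp_group[OF assms])

text \<open>Inverses of generators enter through \<open>a ** b = mat 1\<close>, so that applications
  deal with matrix identities only; invertibility of the generators ties such a \<open>b\<close> to
  the inverse in \<open>GL4\<close>.\<close>

lemma mgen_induct [consumes 1, case_names invertible one gen inverse mult]:
  assumes "x \<in> mgen A" "\<And>a. a \<in> A \<Longrightarrow> invertible a"
    and "P (mat 1)" "\<And>a. a \<in> A \<Longrightarrow> P a"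
    and "\<And>a b. a \<in> A \<Longrightarrow> a ** b = mat 1 \<Longrightarrow> P b" "\<And>a b. P a \<Longrightarrow> P b \<Longrightarrow> P (a ** b)"
  shows "P x"
  using assms(1) unfolding mgen_def
proof (induction rule: generate.induct)
  case (inv h)
  obtain k where "h ** k = mat 1" using assms(2)[OF inv] unfolding invertible_def by auto
  then show ?case using assms(5)[OF inv] inv_GL4 by auto
qed (use assms in auto)

lemma mgen_mult: "x \<in> mgen A \<Longrightarrow> y \<in> mgen A \<Longrightarrow> x ** y \<in> mgen A"
  unfolding mgen_def using generate.eng[of x GL4 A y] by simp

lemma mgen_incl: "a \<in> A \<Longrightarrow> a \<in> mgen A"
  unfolding mgen_def by (rule generate.incl)

lemma subgroup_mgen:
  assumes "\<And>a. a \<in> A \<Longrightarrow> invertible a"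
  shows "subgroup (mgen A) GL4"
  unfolding mgen_def using assms by (intro GL4.generate_is_subgroup) auto

lemma mgen_subset:
  assumes "A \<subseteq> K" "subgroup K GL4"
  shows "mgen A \<subseteq> K"
  unfolding mgen_def by (rule GL4.generate_subgroup_incl[OF assms])

section \<open>Isometries of a form whose matrix is an involution\<close>

text \<open>As \<open>Q\<close> is its own inverse, multiplying the invariance by \<open>Q\<close>
  exhibits \<open>Q ** transpose U ** Q\<close> as a left inverse of \<open>U\<close>, hence a
  two-sided one. Rearranged, this says that \<open>transpose U\<close> is an isometry too, which
  turns facts about columns into facts about rows.\<close>

lemma form_inverse:
  fixes U Q :: mat4
  assumes "Q ** Q = mat 1" "transpose U ** Q ** U = Q"
  shows "U ** (Q ** transpose U ** Q) = mat 1" "U ** Q ** transpose U = Q"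
proof -
  have "(Q ** transpose U ** Q) ** U = Q ** (transpose U ** Q ** U)"
    by (simp add: matrix_mul_assoc)
  then have "(Q ** transpose U ** Q) ** U = mat 1" using assms by simp
  then show *: "U ** (Q ** transpose U ** Q) = mat 1" using matrix_left_right_inverse by blast
  have "U ** Q ** transpose U = (U ** (Q ** transpose U ** Q)) ** Q"
    using assms(1) by (simp add: matrix_mul_assoc[symmetric])
  then show "U ** Q ** transpose U = Q" using * by simp
qed

lemma int_mat_mult:
  assumes "int_mat A" "int_mat B"
  shows "int_mat (A ** B)"
  using assms by (auto simp: int_mat_def matrix_matrix_mult_def intro!: Ints_sum Ints_mult)

lemma int_mat_transpose: "int_mat A \<Longrightarrow> int_mat (transpose A)"
  by (auto simp: int_mat_def transpose_def)

lemma int_mat_one: "int_mat (mat 1)"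
  by (auto simp: int_mat_def mat_def)

lemma int_matE:
  assumes "int_mat A"
  obtains u :: "4 \<Rightarrow> 4 \<Rightarrow> int" where "A = (\<chi> i j. of_int (u i j))"
proof
  show "A = (\<chi> i j. of_int (\<lfloor>A $ i $ j\<rfloor>))"
    using assms by (simp add: int_mat_def vec_eq_iff)
qed

text \<open>The inverse is \<open>Q ** transpose U ** Q\<close>, which preserves the form
  automatically; its integrality is a hypothesis because \<open>Q_D\<close> has half-integral
  entries.\<close>

lemma subgroup_form:
  fixes Q :: mat4
  assumes Q: "Q ** Q = mat 1" "transpose Q = Q"
    and int: "\<And>U. int_mat U \<Longrightarrow> transpose U ** Q ** U = Q \<Longrightarrow> int_mat (Q ** transpose U ** Q)"
  shows "subgroup {U. int_mat U \<and> transpose U ** Q ** U = Q} GL4"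
proof (rule GL4.subgroupI)
  fix U assume "U \<in> {U. int_mat U \<and> transpose U ** Q ** U = Q}"
  then have U: "int_mat U" "transpose U ** Q ** U = Q" by auto
  let ?V = "Q ** transpose U ** Q"
  have "transpose ?V ** Q ** ?V = Q ** U ** (Q ** Q) ** Q ** transpose U ** Q"
    using Q(2) by (simp add: matrix_transpose_mul matrix_mul_assoc)
  also have "\<dots> = Q ** (U ** Q ** transpose U) ** Q"
    using Q(1) by (simp add: matrix_mul_assoc)
  also have "\<dots> = Q" using form_inverse(2)[OF Q(1) U(2)] Q(1) by simp
  finally show "inv\<^bsub>GL4\<^esub> U \<in> {U. int_mat U \<and> transpose U ** Q ** U = Q}"
    using inv_GL4[OF form_inverse(1)[OF Q(1) U(2)]] int[OF U] by simp
next
  fix U V assume "U \<in> {U. int_mat U \<and> transpose U ** Q ** U = Q}"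
    "V \<in> {U. int_mat U \<and> transpose U ** Q ** U = Q}"
  then have UV: "int_mat U" "transpose U ** Q ** U = Q" "int_mat V" "transpose V ** Q ** V = Q"
    by auto
  have "transpose (U ** V) ** Q ** (U ** V) = transpose V ** (transpose U ** Q ** U) ** V"
    by (simp add: matrix_transpose_mul matrix_mul_assoc)
  then show "U \<otimes>\<^bsub>GL4\<^esub> V \<in> {U. int_mat U \<and> transpose U ** Q ** U = Q}"
    using UV by (simp add: int_mat_mult)
next
  show "{U. int_mat U \<and> transpose U ** Q ** U = Q} \<subseteq> carrier GL4"
    using form_inverse(1)[OF Q(1)] matrix_left_right_inverse by (auto simp: invertible_def)
  show "{U. int_mat U \<and> transpose U ** Q ** U = Q} \<noteq> {}"
    using int_mat_one by (auto intro!: exI[of _ "mat 1"] simp: transpose_mat)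
qed

section \<open>The Descartes form\<close>

lemma Q_D_nth: "Q_D $ i $ j = (if i = j then 1 else 0) - 1 / 2"
  by (simp add: Q_D_def mat_def)

lemma transpose_Q_D: "transpose Q_D = Q_D"
  by (auto simp: vec_eq_iff transpose_def Q_D_nth)

lemma sum_delta_minus_half:
  fixes f :: "4 \<Rightarrow> real"
  shows "(\<Sum>k\<in>UNIV. ((if i = k then 1 else 0) - 1 / 2) * f k) = f i - (\<Sum>k\<in>UNIV. f k) / 2"
proof -
  have "(\<Sum>k\<in>UNIV. ((if i = k then 1 else 0) - 1 / 2) * f k)
    = (\<Sum>k\<in>UNIV. (if i = k then f k else 0) - f k / 2)"
    by (rule sum.cong) (auto simp: algebra_simps)
  also have "\<dots> = f i - (\<Sum>k\<in>UNIV. f k) / 2"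
    by (simp add: sum_subtractf sum_divide_distrib)
  finally show ?thesis .
qed

lemma Q_D_mult: "(Q_D ** U) $ i $ j = U $ i $ j - (\<Sum>k\<in>UNIV. U $ k $ j) / 2"
  by (simp add: matrix_matrix_mult_def Q_D_nth sum_delta_minus_half)

lemma mult_Q_D: "(U ** Q_D) $ i $ j = U $ i $ j - (\<Sum>k\<in>UNIV. U $ i $ k) / 2"
proof -
  have "U ** Q_D = transpose (Q_D ** transpose U)"
    by (simp add: matrix_transpose_mul transpose_Q_D)
  then show ?thesis by (simp add: Q_D_mult transpose_def)
qed

lemma Q_D_squared: "Q_D ** Q_D = mat 1"
  by (simp add: vec_eq_iff Q_D_mult Q_D_nth mat_def sum_subtractf)

lemma form_Q_D: "(transpose U ** Q_D ** U) $ i $ j =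
    (\<Sum>k\<in>UNIV. U $ k $ i * U $ k $ j) - (\<Sum>k\<in>UNIV. U $ k $ i) * (\<Sum>k\<in>UNIV. U $ k $ j) / 2"
proof -
  have "(transpose U ** Q_D ** U) $ i $ j = (\<Sum>k\<in>UNIV. U $ k $ i * (Q_D ** U) $ k $ j)"
    unfolding matrix_mul_assoc[symmetric]
    by (subst matrix_matrix_mult_def) (simp add: transpose_def)
  also have "\<dots> = (\<Sum>k\<in>UNIV. U $ k $ i * U $ k $ j - U $ k $ i * ((\<Sum>k\<in>UNIV. U $ k $ j) / 2))"
    by (simp add: Q_D_mult algebra_simps)
  also have "\<dots> = (\<Sum>k\<in>UNIV. U $ k $ i * U $ k $ j) - (\<Sum>k\<in>UNIV. U $ k $ i) * ((\<Sum>k\<in>UNIV. U $ k $ j) / 2)"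
    by (simp add: sum_subtractf sum_distrib_right)
  finally show ?thesis by simp
qed

text \<open>With \<open>n\<close> the sum of squares and \<open>s\<close> the sum of column
  \<open>j\<close>, the diagonal entry of the form reads \<open>n - s^2 / 2 = 1 / 2\<close>, so
  \<open>s^2 = 2 n - 1\<close>.\<close>

lemma odd_col_sum:
  fixes u :: "4 \<Rightarrow> 4 \<Rightarrow> int"
  assumes U: "U = (\<chi> i j. of_int (u i j))" and form: "transpose U ** Q_D ** U = Q_D"
  shows "odd (\<Sum>k\<in>UNIV. u k j)"
proof -
  let ?s = "\<Sum>k\<in>UNIV. u k j" and ?n = "\<Sum>k\<in>UNIV. u k j * u k j"
  have "(transpose U ** Q_D ** U) $ j $ j = 1 / 2" using form by (simp add: Q_D_nth)
  then have "of_int ?n - of_int ?s * of_int ?s / 2 = (1 / 2 :: real)"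
    unfolding form_Q_D by (simp add: U)
  then have "of_int (?s * ?s) = (of_int (2 * ?n - 1) :: real)" by (simp add: field_simps)
  then have "?s * ?s = 2 * ?n - 1" by (simp only: of_int_eq_iff)
  then have "odd (?s * ?s)" by simp
  then show ?thesis by simp
qed

lemma odd_row_sum:
  fixes u :: "4 \<Rightarrow> 4 \<Rightarrow> int"
  assumes U: "U = (\<chi> i j. of_int (u i j))" and form: "transpose U ** Q_D ** U = Q_D"
  shows "odd (\<Sum>k\<in>UNIV. u i k)"
  using odd_col_sum[of "transpose U" "\<lambda>i j. u j i"] form_inverse(2)[OF Q_D_squared form]
  by (simp add: U transpose_def)

text \<open>The row sums are the image under \<open>U\<close> of the all-ones vector, and
  \<open>U\<close> preserves the value of the form there, which is \<open>4 - 16 / 2 = -4\<close>.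
  The proof sums the entrywise identity \<open>form_Q_D\<close> over all \<open>i\<close> and
  \<open>j\<close>.\<close>

lemma row_sum_form:
  assumes "transpose U ** Q_D ** U = Q_D"
  shows "(\<Sum>k\<in>UNIV. (\<Sum>j\<in>UNIV. U $ k $ j)\<^sup>2) - (\<Sum>k\<in>UNIV. \<Sum>j\<in>UNIV. U $ k $ j)\<^sup>2 / 2 = -4"
proof -
  let ?s = "\<lambda>j. \<Sum>k\<in>UNIV. U $ k $ j"
  have "(\<Sum>i\<in>UNIV. \<Sum>j\<in>UNIV. Q_D $ i $ j) = -4"
    by (simp add: Q_D_nth sum_subtractf)
  moreover have "Q_D $ i $ j = (\<Sum>k\<in>UNIV. U $ k $ i * U $ k $ j) - ?s i * ?s j / 2" for i j
    using form_Q_D[of U i j] assms by simp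
  ultimately have "(\<Sum>i\<in>UNIV. \<Sum>j\<in>UNIV. \<Sum>k\<in>UNIV. U $ k $ i * U $ k $ j)
      - (\<Sum>i\<in>UNIV. \<Sum>j\<in>UNIV. ?s i * ?s j) / 2 = -4"
    by (simp add: sum_subtractf sum_divide_distrib)
  moreover have "(\<Sum>i\<in>UNIV. \<Sum>j\<in>UNIV. \<Sum>k\<in>UNIV. U $ k $ i * U $ k $ j)
      = (\<Sum>k\<in>UNIV. (\<Sum>j\<in>UNIV. U $ k $ j)\<^sup>2)"
  proof -
    have "(\<Sum>i\<in>UNIV. \<Sum>j\<in>UNIV. \<Sum>k\<in>UNIV. U $ k $ i * U $ k $ j)
      = (\<Sum>i\<in>UNIV. \<Sum>k\<in>UNIV. \<Sum>j\<in>UNIV. U $ k $ i * U $ k $ j)"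
      by (intro sum.cong refl sum.swap)
    also have "\<dots> = (\<Sum>k\<in>UNIV. \<Sum>i\<in>UNIV. \<Sum>j\<in>UNIV. U $ k $ i * U $ k $ j)"
      by (rule sum.swap)
    finally show ?thesis by (simp add: power2_eq_square sum_product)
  qed
  moreover have "(\<Sum>i\<in>UNIV. \<Sum>j\<in>UNIV. ?s i * ?s j) = (\<Sum>k\<in>UNIV. \<Sum>j\<in>UNIV. U $ k $ j)\<^sup>2"
    unfolding sum.swap[of "\<lambda>k j. U $ k $ j" UNIV UNIV] power2_eq_square
    by (simp add: sum_product)
  ultimately show ?thesis by simp
qed

lemma row_sum_form_int:
  fixes u :: "4 \<Rightarrow> 4 \<Rightarrow> int"
  assumes U: "U = (\<chi> i j. of_int (u i j))" and form: "transpose U ** Q_D ** U = Q_D"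
  shows "2 * (\<Sum>k\<in>UNIV. (\<Sum>j\<in>UNIV. u k j)\<^sup>2) = (\<Sum>k\<in>UNIV. \<Sum>j\<in>UNIV. u k j)\<^sup>2 - 8"
proof -
  have "of_int (2 * (\<Sum>k\<in>UNIV. (\<Sum>j\<in>UNIV. u k j)\<^sup>2))
    = (of_int ((\<Sum>k\<in>UNIV. \<Sum>j\<in>UNIV. u k j)\<^sup>2 - 8) :: real)"
    using row_sum_form[OF form] by (simp add: U)
  then show ?thesis by (simp only: of_int_eq_iff)
qed

text \<open>Write the sum as \<open>2 t\<close>. Odd squares are 1 modulo 4, so with
  \<open>(v k)^2 = 4 * m k + 1\<close> the form gives
  \<open>t^2 = 2 (m 1 + m 2 + m 3 + m 4 + 2)\<close>, whence \<open>t\<close> is even.\<close>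

lemma four_dvd_sum_of_odds:
  fixes v :: "4 \<Rightarrow> int"
  assumes odd: "\<And>k. odd (v k)" and form: "2 * (\<Sum>k\<in>UNIV. (v k)\<^sup>2) = (\<Sum>k\<in>UNIV. v k)\<^sup>2 - 8"
  shows "4 dvd (\<Sum>k\<in>UNIV. v k)"
proof -
  let ?s = "\<Sum>k\<in>UNIV. v k"
  have "even ?s" using odd by (simp add: sum_4)
  then obtain t where t: "?s = 2 * t" by blast
  have "\<exists>m. (v k)\<^sup>2 = 4 * m + 1" for k
  proof -
    obtain a where "v k = 2 * a + 1" using odd[of k] by (auto elim: oddE)
    then have "(v k)\<^sup>2 = 4 * (a\<^sup>2 + a) + 1" by (simp add: power2_eq_square algebra_simps)
    then show ?thesis by blast
  qed
  then obtain m where "\<And>k. (v k)\<^sup>2 = 4 * m k + 1" by metis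
  then have "2 * (4 * (\<Sum>k\<in>UNIV. m k) + 4) = 4 * t\<^sup>2 - 8"
    using form t by (simp add: sum.distrib sum_distrib_left power2_eq_square)
  then have "t\<^sup>2 = 2 * ((\<Sum>k\<in>UNIV. m k) + 2)" by simp
  then have "even (t\<^sup>2)" by simp
  then have "even t" by simp
  then show ?thesis using t by auto
qed

lemma Aut_QD_total:
  fixes u :: "4 \<Rightarrow> 4 \<Rightarrow> int"
  assumes "U = (\<chi> i j. of_int (u i j))" "transpose U ** Q_D ** U = Q_D"
  shows "4 dvd (\<Sum>k\<in>UNIV. \<Sum>j\<in>UNIV. u k j)"
  using four_dvd_sum_of_odds[OF odd_row_sum[OF assms] row_sum_form_int[OF assms]] .

lemma subgroup_Aut_QD: "subgroup Aut_QD GL4"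
  unfolding Aut_QD_def
proof (rule subgroup_form[OF Q_D_squared transpose_Q_D])
  fix U assume "int_mat U" and form: "transpose U ** Q_D ** U = Q_D"
  then obtain u where u: "U = (\<chi> i j. of_int (u i j))" using int_matE by blast
  let ?r = "\<lambda>i. \<Sum>k\<in>UNIV. u i k" and ?c = "\<lambda>j. \<Sum>k\<in>UNIV. u k j"
  obtain t where t: "(\<Sum>k\<in>UNIV. ?r k) = 4 * t" using Aut_QD_total[OF u form] by blast
  \<comment> \<open>The entry is \<open>u j i - r j / 2 - c i / 2 + s / 4\<close> with row sums
    \<open>r\<close>, column sums \<open>c\<close> and total \<open>s\<close>; two halves of odd
    numbers add up to an integer, and 4 divides \<open>s\<close>.\<close>
  have entry: "(Q_D ** transpose U ** Q_D) $ i $ j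
      = of_int (u j i) - of_int (?r j) / 2 - (of_int (?c i) - of_int (\<Sum>k\<in>UNIV. ?r k) / 2) / 2"
    for i j
    by (simp add: mult_Q_D Q_D_mult transpose_def u sum_subtractf sum_divide_distrib)
  show "int_mat (Q_D ** transpose U ** Q_D)"
    unfolding int_mat_def
  proof (intro allI)
    fix i j
    obtain a where a: "?r j = 2 * a + 1" using odd_row_sum[OF u form, of j] by (auto elim: oddE)
    obtain b where b: "?c i = 2 * b + 1" using odd_col_sum[OF u form, of i] by (auto elim: oddE)
    have "(Q_D ** transpose U ** Q_D) $ i $ j = of_int (u j i - a - b - 1 + t)"
      unfolding entry a b t by (simp add: field_simps)
    then show "(Q_D ** transpose U ** Q_D) $ i $ j \<in> \<int>" by simp
  qed
qed

section \<open>Descent\<close>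

text \<open>The sum of the row sums changes from \<open>s\<close> to \<open>3 s - 4 v k\<close> under \<open>S_mat k\<close> and to
  \<open>s + 4 v k\<close> under its transpose.\<close>

lemma descent_pos:
  fixes v :: "4 \<Rightarrow> int"
  assumes odd: "\<And>k. odd (v k)" and form: "2 * (\<Sum>k\<in>UNIV. (v k)\<^sup>2) = (\<Sum>k\<in>UNIV. v k)\<^sup>2 - 8"
    and pos: "(\<Sum>k\<in>UNIV. v k) > 0"
    and stuck: "\<And>k. \<not> \<bar>3 * (\<Sum>k\<in>UNIV. v k) - 4 * v k\<bar> < (\<Sum>k\<in>UNIV. v k)"
      "\<And>k. \<not> \<bar>(\<Sum>k\<in>UNIV. v k) + 4 * v k\<bar> < (\<Sum>k\<in>UNIV. v k)"
  shows "v k = 1"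
proof -
  obtain m where m: "(\<Sum>k\<in>UNIV. v k) = 4 * m" using four_dvd_sum_of_odds[OF odd form] by blast
  define t where "t = 2 * m"
  have t: "(\<Sum>k\<in>UNIV. v k) = 2 * t" and t0: "t > 0" and tev: "even t"
    using m pos by (auto simp: t_def)
  have sq: "(\<Sum>k\<in>UNIV. (v k)\<^sup>2) = 2 * t\<^sup>2 - 4" using form t by (simp add: power2_eq_square)
  \<comment> \<open>With sum \<open>2 t\<close>, \<open>S_mat k\<close> lowers the absolute sum iff
    \<open>t < v k < 2 t\<close>, its transpose iff \<open>- t < v k < 0\<close>. The values
    \<open>0\<close>, \<open>t\<close> and \<open>- t\<close> are excluded by parity, as
    \<open>t\<close> is even, and \<open>\<bar>v k\<bar> < 2 t\<close> follows from the
    form.\<close>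
  have range: "(0 < v k \<and> v k < t) \<or> v k < - t" for k
  proof -
    have "(v k)\<^sup>2 \<le> (\<Sum>k\<in>UNIV. (v k)\<^sup>2)" by (rule member_le_sum) auto
    also have "\<dots> < (2 * t)\<^sup>2" using sq t0 by (simp add: power_mult_distrib) (smt (verit) zero_le_power2)
    finally have "\<bar>v k\<bar> < 2 * t" using t0 abs_le_square_iff[of "2 * t" "v k"] by linarith
    moreover have "v k \<noteq> t" "v k \<noteq> - t" "v k \<noteq> 0" using odd[of k] tev by auto
    ultimately show ?thesis using stuck[of k] unfolding t by linarith
  qed
  have tsum: "v 1 + v 2 + v 3 + v 4 = 2 * t" using t by (simp add: sum_4)
  \<comment> \<open>If some \<open>v k < - t\<close>, the other three, each below \<open>t\<close>,
    would keep the sum below \<open>2 t\<close>.\<close>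
  have rng: "0 < v k \<and> v k < t" for k
    using range[of 1] range[of 2] range[of 3] range[of 4] tsum t0 exhaust_4[of k] by auto
  \<comment> \<open>Summing this over \<open>k\<close> compares
    \<open>t * (2 t) - (2 t^2 - 4) = 4\<close> with \<open>2 t\<close>; hence
    \<open>t \<le> 2\<close>, and \<open>0 < v k < t\<close> forces \<open>v k = 1\<close>.\<close>
  have summand: "v k * (t - v k) \<ge> v k" for k
    using mult_left_mono[of 1 "t - v k" "v k"] rng[of k] by simp
  have "(\<Sum>k\<in>UNIV. v k * (t - v k)) = t * (2 * t) - (2 * t\<^sup>2 - 4)"
    unfolding t[symmetric] sq[symmetric]
    by (simp add: sum_subtractf sum_distrib_left power2_eq_square algebra_simps)
  then have "(\<Sum>k\<in>UNIV. v k * (t - v k)) = 4" by (simp add: power2_eq_square)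
  moreover have "(\<Sum>k\<in>UNIV. v k) \<le> (\<Sum>k\<in>UNIV. v k * (t - v k))" by (rule sum_mono) (rule summand)
  ultimately have "t \<le> 2" using t by simp
  then show ?thesis using rng[of k] by simp
qed

text \<open>The hypotheses and both decrease conditions are invariant under
  \<open>v \<mapsto> - v\<close>, which reduces negative sums to \<open>descent_pos\<close>; a zero
  sum would make the sum of squares negative.\<close>

lemma descent:
  fixes v :: "4 \<Rightarrow> int"
  assumes odd: "\<And>k. odd (v k)" and form: "2 * (\<Sum>k\<in>UNIV. (v k)\<^sup>2) = (\<Sum>k\<in>UNIV. v k)\<^sup>2 - 8"
  obtains "\<And>k. v k = 1" | "\<And>k. v k = -1"
  | k where "\<bar>3 * (\<Sum>k\<in>UNIV. v k) - 4 * v k\<bar> < \<bar>\<Sum>k\<in>UNIV. v k\<bar>"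
  | k where "\<bar>(\<Sum>k\<in>UNIV. v k) + 4 * v k\<bar> < \<bar>\<Sum>k\<in>UNIV. v k\<bar>"
proof -
  let ?s = "\<Sum>k\<in>UNIV. v k"
  have "?s \<noteq> 0"
  proof
    assume "?s = 0"
    then have "(\<Sum>k\<in>UNIV. (v k)\<^sup>2) < 0" using form by simp
    moreover have "(\<Sum>k\<in>UNIV. (v k)\<^sup>2) \<ge> 0" by (rule sum_nonneg) simp
    ultimately show False by simp
  qed
  then consider "?s > 0" | "?s < 0" by linarith
  then show ?thesis
  proof cases
    case 1
    then show ?thesis using descent_pos[OF odd form] that by (metis abs_of_pos)
  next
    case 2
    have n: "(\<Sum>k\<in>UNIV. - v k) = - ?s" by (simp add: sum_negf)
    have f: "2 * (\<Sum>k\<in>UNIV. (- v k)\<^sup>2) = (\<Sum>k\<in>UNIV. - v k)\<^sup>2 - 8" using form n by simp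
    have a: "\<bar>3 * - ?s - 4 * - v k\<bar> = \<bar>3 * ?s - 4 * v k\<bar>" "\<bar>- ?s + 4 * - v k\<bar> = \<bar>?s + 4 * v k\<bar>" for k
      by linarith+
    show ?thesis
    proof (cases "\<exists>k. \<bar>3 * ?s - 4 * v k\<bar> < \<bar>?s\<bar> \<or> \<bar>?s + 4 * v k\<bar> < \<bar>?s\<bar>")
      case True
      then show ?thesis using that by blast
    next
      case False
      have "- v k = 1" for k
        by (rule descent_pos[of "\<lambda>k. - v k"]) (use False odd f 2 a in \<open>auto simp: n\<close>)
      then show ?thesis using that(2) by (metis minus_minus)
    qed
  qed
qed

section \<open>Generators\<close>

lemma S_mat_mult: "(S_mat k ** U) $ i $ j = (if i = k then 2 * (\<Sum>l\<in>UNIV. U $ l $ j) - 3 * U $ k $ j else U $ i $ j)"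
  using exhaust_4[of k] exhaust_4[of i]
  by (auto simp: matrix_matrix_mult_def S_mat_def sum_4)

lemma transpose_S_mat_mult: "(transpose (S_mat k) ** U) $ i $ j = (if i = k then - U $ k $ j else U $ i $ j + 2 * U $ k $ j)"
  using exhaust_4[of k] exhaust_4[of i]
  by (auto simp: matrix_matrix_mult_def S_mat_def transpose_def sum_4)

lemma S_mat_squared: "S_mat k ** S_mat k = mat 1"
  unfolding vec_eq_iff S_mat_mult using exhaust_4[of k]
  by (auto simp: S_mat_def mat_def sum_4 forall_4)

lemma transpose_S_mat_squared: "transpose (S_mat k) ** transpose (S_mat k) = mat 1"
  by (simp add: matrix_transpose_mul[symmetric] S_mat_squared transpose_mat)

text \<open>\<open>Q_D\<close> intertwines a generator with its transpose. Together with
  \<open>S_mat_squared\<close> this makes the generators isometries; and since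
  \<open>D_mat = - Q_D\<close>, it later shows that conjugation by \<open>D_mat\<close> exchanges
  the two families of generators.\<close>

lemma transpose_Q_D_S_mat: "transpose (S_mat k) ** Q_D = Q_D ** S_mat k"
  unfolding vec_eq_iff Q_D_mult mult_Q_D using exhaust_4[of k]
  by (auto simp: S_mat_def transpose_def sum_4 forall_4)

lemma S_mat_Q_D: "S_mat k ** Q_D = Q_D ** transpose (S_mat k)"
proof -
  have "S_mat k ** Q_D = Q_D ** (Q_D ** S_mat k) ** Q_D"
    by (simp add: matrix_mul_assoc Q_D_squared)
  also have "\<dots> = Q_D ** transpose (S_mat k) ** (Q_D ** Q_D)"
    unfolding transpose_Q_D_S_mat[symmetric] by (simp add: matrix_mul_assoc)
  finally show ?thesis by (simp add: Q_D_squared)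
qed

lemma S_mat_in_Aut_QD: "S_mat k \<in> Aut_QD"
proof -
  have "transpose (S_mat k) ** Q_D ** S_mat k = Q_D"
    by (simp add: transpose_Q_D_S_mat matrix_mul_assoc[symmetric] S_mat_squared)
  then show ?thesis by (auto simp: Aut_QD_def int_mat_def S_mat_def)
qed

lemma transpose_S_mat_in_Aut_QD: "transpose (S_mat k) \<in> Aut_QD"
proof -
  have "S_mat k ** Q_D ** transpose (S_mat k) = Q_D"
    by (simp add: S_mat_Q_D matrix_mul_assoc[symmetric] transpose_S_mat_squared)
  then show ?thesis by (auto simp: Aut_QD_def int_mat_def S_mat_def transpose_def)
qed

abbreviation apollonian_gens :: "mat4 set" where
  "apollonian_gens \<equiv> range S_mat \<union> transpose ` range S_mat"

lemma apollonian_gens_invertible: "a \<in> apollonian_gens \<Longrightarrow> invertible a"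
  using subgroup.subset[OF subgroup_Aut_QD] S_mat_in_Aut_QD transpose_S_mat_in_Aut_QD by auto

lemma subgroup_super_apollonian: "subgroup super_apollonian GL4"
  unfolding super_apollonian_def by (rule subgroup_mgen) (rule apollonian_gens_invertible)

lemma super_apollonian_subset: "super_apollonian \<subseteq> Aut_QD"
  unfolding super_apollonian_def
  by (rule mgen_subset[OF _ subgroup_Aut_QD]) (auto simp: S_mat_in_Aut_QD transpose_S_mat_in_Aut_QD)

lemma S_mat_in_super_apollonian: "S_mat k \<in> super_apollonian"
  and transpose_S_mat_in_super_apollonian: "transpose (S_mat k) \<in> super_apollonian"
  unfolding super_apollonian_def by (auto intro: mgen_incl)

section \<open>Permutation matrices\<close>

definition perm_mat :: "(4 \<Rightarrow> 4) \<Rightarrow> mat4" where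
  "perm_mat p = (\<chi> i j. if p i = j then 1 else 0)"

lemma perm_mats_eq: "perm_mats = perm_mat ` {p. p permutes UNIV}"
  by (auto simp: perm_mats_def perm_mat_def)

lemma perm_mat_mult: "(perm_mat p ** U) $ i $ j = U $ p i $ j"
proof -
  have "(perm_mat p ** U) $ i $ j = (\<Sum>k\<in>UNIV. if p i = k then U $ k $ j else 0)"
    unfolding matrix_matrix_mult_def perm_mat_def vec_lambda_beta by (intro sum.cong) auto
  then show ?thesis by simp
qed

lemma mult_perm_mat:
  assumes "p permutes UNIV"
  shows "(U ** perm_mat p) $ i $ j = U $ i $ inv_into UNIV p j"
proof -
  have "p k = j \<longleftrightarrow> inv_into UNIV p j = k" for k using permutes_inverses[OF assms] by metis
  then have "(U ** perm_mat p) $ i $ j = (\<Sum>k\<in>UNIV. if inv_into UNIV p j = k then U $ i $ k else 0)"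
    unfolding matrix_matrix_mult_def perm_mat_def vec_lambda_beta by (intro sum.cong) auto
  then show ?thesis by simp
qed

text \<open>Row \<open>i\<close> of \<open>perm_mat p ** U\<close> is row \<open>p i\<close> of
  \<open>U\<close>, so multiplication reverses the order of composition.\<close>

lemma perm_mat_mult_perm_mat: "perm_mat p ** perm_mat q = perm_mat (q \<circ> p)"
  by (simp add: vec_eq_iff perm_mat_mult) (simp add: perm_mat_def)

lemma perm_mat_id: "perm_mat id = mat 1"
  by (simp add: vec_eq_iff perm_mat_def mat_def)

lemma perm_mat_inverse:
  assumes "p permutes UNIV"
  shows "perm_mat p ** perm_mat (inv_into UNIV p) = mat 1"
  using permutes_inv_o(2)[OF assms] by (simp add: perm_mat_mult_perm_mat perm_mat_id)

text \<open>The entries of \<open>Q_D\<close> depend only on whether the two indices agree, so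
  permuting rows and columns simultaneously fixes it.\<close>

lemma perm_mat_Q_D:
  assumes "p permutes UNIV"
  shows "perm_mat p ** Q_D = Q_D ** perm_mat p"
proof -
  have "p i = j \<longleftrightarrow> i = inv_into UNIV p j" for i j using permutes_inverses[OF assms] by metis
  then show ?thesis by (simp add: vec_eq_iff perm_mat_mult mult_perm_mat[OF assms] Q_D_nth)
qed

lemma transpose_perm_mat:
  assumes "p permutes UNIV"
  shows "transpose (perm_mat p) = perm_mat (inv_into UNIV p)"
proof -
  have "p i = j \<longleftrightarrow> inv_into UNIV p j = i" for i j using permutes_inverses[OF assms] by metis
  then show ?thesis by (simp add: vec_eq_iff transpose_def perm_mat_def)
qed

lemma perm_mat_in_Aut_QD:
  assumes p: "p permutes UNIV"
  shows "perm_mat p \<in> Aut_QD"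
proof -
  have "transpose (perm_mat p) ** Q_D ** perm_mat p = Q_D ** (perm_mat (inv_into UNIV p) ** perm_mat p)"
    by (simp add: transpose_perm_mat[OF p] perm_mat_Q_D[OF permutes_inv[OF p]] matrix_mul_assoc)
  also have "\<dots> = Q_D"
    by (simp add: perm_mat_mult_perm_mat permutes_inv_o(1)[OF p] perm_mat_id)
  finally show ?thesis by (auto simp: Aut_QD_def int_mat_def perm_mat_def)
qed

lemma perm_mat_S_mat:
  assumes p: "p permutes UNIV"
  shows "perm_mat p ** S_mat k = S_mat (inv_into UNIV p k) ** perm_mat p"
proof -
  have "p i = j \<longleftrightarrow> i = inv_into UNIV p j" for i j using permutes_inverses[OF p] by metis
  then show ?thesis by (simp add: vec_eq_iff perm_mat_mult mult_perm_mat[OF p] S_mat_def)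
      (metis)
qed

lemma perm_mat_transpose_S_mat:
  assumes p: "p permutes UNIV"
  shows "perm_mat p ** transpose (S_mat k) = transpose (S_mat (inv_into UNIV p k)) ** perm_mat p"
proof -
  have "p i = j \<longleftrightarrow> i = inv_into UNIV p j" for i j using permutes_inverses[OF p] by metis
  then show ?thesis
    by (simp add: vec_eq_iff perm_mat_mult mult_perm_mat[OF p] S_mat_def transpose_def) metis
qed

section \<open>The finite group\<close>

lemma minus_mult: "(- A) ** B = - (A ** B)" and mult_minus: "A ** (- B) = - (A ** B)" for A B :: mat4
  by (simp_all add: vec_eq_iff matrix_matrix_mult_def sum_negf)

lemma minus_in_Aut_QD: "U \<in> Aut_QD \<Longrightarrow> - U \<in> Aut_QD"
proof -
  assume U: "U \<in> Aut_QD"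
  have "transpose (- U) = - transpose U" by (simp add: vec_eq_iff transpose_def)
  then show ?thesis using U by (simp add: Aut_QD_def int_mat_def minus_mult mult_minus)
qed

text \<open>Since \<open>- mat 1\<close> is central of order 2 and the permutation matrices are
  closed under products and inverses, the union is already a group.\<close>

lemma perm_sign_group_eq: "perm_sign_group = perm_mats \<union> uminus ` perm_mats"
proof
  let ?F = "perm_mats \<union> uminus ` perm_mats"
  have one: "mat 1 \<in> perm_mats" unfolding perm_mats_eq perm_mat_id[symmetric] using permutes_id by blast
  have inv_gens: "invertible a" if a: "a \<in> perm_mats \<union> {- mat 1}" for a
  proof -
    have "a \<in> Aut_QD"
      using a one minus_in_Aut_QD perm_mat_in_Aut_QD by (auto simp: perm_mats_eq)
    then show ?thesis using subgroup.subset[OF subgroup_Aut_QD] by auto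
  qed
  show "perm_sign_group \<subseteq> ?F"
  proof
    fix x assume "x \<in> perm_sign_group"
    then show "x \<in> ?F"
      unfolding perm_sign_group_def
    proof (induction rule: mgen_induct)
      case (invertible a)
      then show ?case by (rule inv_gens)
    next
      case one
      show ?case using \<open>mat 1 \<in> perm_mats\<close> by simp
    next
      case (gen a)
      then show ?case using one by auto
    next
      case (inverse a b)
      \<comment> \<open>Inverses are unique, so \<open>b\<close> is identified with any explicitly
        known inverse of \<open>a\<close>.\<close>
      have inv: "b = c" if "a ** c = mat 1" for c
      proof -
        have "b = b ** (a ** c)" using that by simp
        also have "\<dots> = c" using inverse(2) matrix_left_right_inverse[of a b] by (simp add: matrix_mul_assoc)
        finally show ?thesis .
      qed
      from inverse(1) consider p where "p permutes UNIV" "a = perm_mat p" | "a = - mat 1"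
        by (auto simp: perm_mats_eq)
      then show ?case
      proof cases
        case 1
        then show ?thesis
          using inv[of "perm_mat (inv_into UNIV p)"] perm_mat_inverse permutes_inv by (auto simp: perm_mats_eq)
      next
        case 2
        then show ?thesis using inv[of "- mat 1"] one by (auto simp: minus_mult mult_minus)
      qed
    next
      case (mult a b)
      have "x ** y \<in> perm_mats" if "x \<in> perm_mats" "y \<in> perm_mats" for x y
        using that by (auto simp: perm_mats_eq perm_mat_mult_perm_mat intro!: imageI permutes_compose)
      then show ?case using mult by (auto simp: minus_mult mult_minus)
    qed
  qed
  have "- x \<in> perm_sign_group" if "x \<in> perm_mats" for x
    using mgen_mult[of "- mat 1" "perm_mats \<union> {- mat 1}" x] that
    unfolding perm_sign_group_def by (simp add: mgen_incl minus_mult)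
  then show "?F \<subseteq> perm_sign_group"
    by (auto simp: perm_sign_group_def intro: mgen_incl)
qed

lemma perm_sign_group_cases:
  assumes "f \<in> perm_sign_group"
  obtains p where "p permutes UNIV" "f = perm_mat p" | p where "p permutes UNIV" "f = - perm_mat p"
  using assms unfolding perm_sign_group_eq perm_mats_eq by auto

lemma card_perm_sign_group: "card perm_sign_group = 48"
proof -
  have "inj_on perm_mat {p. p permutes UNIV}"
  proof (rule inj_onI)
    fix p q assume "perm_mat p = perm_mat q"
    then have "(p i = j) = (q i = j)" for i j by (simp add: vec_eq_iff perm_mat_def) (metis zero_neq_one)
    then show "p = q" by blast
  qed
  then have card: "card perm_mats = 24"
    unfolding perm_mats_eq by (simp add: card_image card_permutations fact_numeral)
  then have fin: "finite perm_mats" using card.infinite by fastforce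
  have "perm_mats \<inter> uminus ` perm_mats = {}"
  proof -
    \<comment> \<open>At position \<open>(1, p 1)\<close> the left side is 1 while the right side is
      0 or -1.\<close>
    have False if "perm_mat p = - perm_mat q" for p q
    proof -
      have "perm_mat p $ 1 $ p 1 = - perm_mat q $ 1 $ p 1" using that by simp
      then show False by (simp add: perm_mat_def split: if_splits)
    qed
    then show ?thesis by (auto simp: perm_mats_eq)
  qed
  then show ?thesis
    unfolding perm_sign_group_eq using fin card by (simp add: card_Un_disjoint card_image)
qed

lemma subgroup_perm_sign_group: "subgroup perm_sign_group GL4"
  unfolding perm_sign_group_def
proof (rule subgroup_mgen)
  fix a assume "a \<in> perm_mats \<union> {- mat 1}"
  moreover have "mat 1 \<in> Aut_QD" using subgroup.one_closed[OF subgroup_Aut_QD] by simp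
  ultimately have "a \<in> Aut_QD" using minus_in_Aut_QD perm_mat_in_Aut_QD by (auto simp: perm_mats_eq)
  then show "invertible a" using subgroup.subset[OF subgroup_Aut_QD] by auto
qed

lemma perm_sign_group_subset: "perm_sign_group \<subseteq> Aut_QD"
  using minus_in_Aut_QD perm_mat_in_Aut_QD by (auto simp: perm_sign_group_eq perm_mats_eq)

section \<open>Factorisation\<close>

text \<open>Invariance under \<open>transpose U\<close> gives each row square sum 1, so together
  with row sum 1 the terms \<open>x * (x - 1)\<close> of a row add up to 0. For integers each term
  is nonnegative, which leaves entries 0 and 1, one 1 in each row; the column sums then show that
  every column is hit.\<close>

lemma Aut_QD_row_sums_one:
  assumes U: "U \<in> Aut_QD" and rows: "\<And>i. (\<Sum>j\<in>UNIV. U $ i $ j) = 1"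
  shows "U \<in> perm_mats"
proof -
  have form: "transpose U ** Q_D ** U = Q_D" and "int_mat U" using U by (auto simp: Aut_QD_def)
  then obtain u where u: "U = (\<chi> i j. of_int (u i j))" using int_matE by blast
  \<comment> \<open>Summing row \<open>i\<close> of the form identity over \<open>j\<close> gives
    \<open>-1 = s i - s i * 4 / 2\<close>, where \<open>s i\<close> is the column sum and 4 the
    total of the row sums; thus \<open>s i = 1\<close>.\<close>
  have cols: "(\<Sum>k\<in>UNIV. U $ k $ i) = 1" for i
  proof -
    let ?s = "\<lambda>j. \<Sum>k\<in>UNIV. U $ k $ j"
    have "Q_D $ i $ j = (\<Sum>k\<in>UNIV. U $ k $ i * U $ k $ j) - ?s i * ?s j / 2" for j
      using form_Q_D[of U i j] form by simp
    then have "(\<Sum>j\<in>UNIV. Q_D $ i $ j) = (\<Sum>j\<in>UNIV. \<Sum>k\<in>UNIV. U $ k $ i * U $ k $ j) - (\<Sum>j\<in>UNIV. ?s i * ?s j / 2)"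
      by (simp add: sum_subtractf)
    also have "(\<Sum>j\<in>UNIV. \<Sum>k\<in>UNIV. U $ k $ i * U $ k $ j) = (\<Sum>k\<in>UNIV. \<Sum>j\<in>UNIV. U $ k $ i * U $ k $ j)"
      by (rule sum.swap)
    also have "\<dots> = ?s i" using rows by (simp add: sum_distrib_left[symmetric])
    also have "(\<Sum>j\<in>UNIV. ?s i * ?s j / 2) = ?s i * (\<Sum>j\<in>UNIV. ?s j) / 2"
      by (simp add: sum_distrib_left sum_divide_distrib)
    also have "(\<Sum>j\<in>UNIV. ?s j) = (\<Sum>k\<in>UNIV. \<Sum>j\<in>UNIV. U $ k $ j)" by (rule sum.swap)
    also have "(\<Sum>j\<in>UNIV. Q_D $ i $ j) = -1" by (simp add: Q_D_nth sum_subtractf)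
    finally show ?thesis using rows by simp
  qed
  have "(\<Sum>k\<in>UNIV. U $ i $ k * U $ i $ k) = 1" for i
    using form_Q_D[of "transpose U" i i] form_inverse(2)[OF Q_D_squared form] rows
    by (simp add: transpose_def Q_D_nth)
  then have "(\<Sum>k\<in>UNIV. U $ i $ k * (U $ i $ k - 1)) = 0" for i
    using rows by (simp add: algebra_simps sum_subtractf)
  moreover have nonneg: "U $ i $ k * (U $ i $ k - 1) \<ge> 0" for i k
  proof -
    have "u i k * (u i k - 1) \<ge> 0" by (cases "u i k \<ge> 1") (auto intro: mult_nonpos_nonpos)
    then have "real_of_int (u i k * (u i k - 1)) \<ge> 0" by (simp only: of_int_0_le_iff)
    then show ?thesis by (simp add: u)
  qed
  ultimately have "U $ i $ k * (U $ i $ k - 1) = 0" for i k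
    by (simp add: sum_nonneg_eq_0_iff)
  then have bin: "U $ i $ k = 0 \<or> U $ i $ k = 1" for i k by simp
  have "\<exists>k. U $ i $ k = 1" for i
    using rows[of i] bin by (metis sum.neutral zero_neq_one)
  then obtain p where p: "\<And>i. U $ i $ p i = 1" by metis
  have uniq: "k = p i" if "U $ i $ k = 1" for i k
  proof (rule ccontr)
    assume "k \<noteq> p i"
    then have "(\<Sum>j\<in>{k, p i}. U $ i $ j) = 2" using p that by simp
    moreover have "(\<Sum>j\<in>{k, p i}. U $ i $ j) \<le> (\<Sum>j\<in>UNIV. U $ i $ j)"
      using bin by (intro sum_mono2) (auto, metis order_refl zero_le_one)
    ultimately show False using rows by simp
  qed
  have "surj p"
  proof (rule surjI[of _ "\<lambda>j. SOME i. p i = j"])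
    fix j
    have "\<exists>i. U $ i $ j = 1" using cols[of j] bin by (metis sum.neutral zero_neq_one)
    then have "\<exists>i. p i = j" using uniq by blast
    then show "p (SOME i. p i = j) = j" by (rule someI_ex)
  qed
  then have "p permutes UNIV"
    using finite_UNIV_surj_inj[of p] by (auto intro!: bij_imp_permutes simp: bij_betw_def)
  moreover have "U $ i $ k = perm_mat p $ i $ k" for i k
    using p[of i] uniq[of i k] bin[of i k] by (auto simp: perm_mat_def)
  then have "U = perm_mat p" by (simp add: vec_eq_iff)
  ultimately show ?thesis unfolding perm_mats_eq by blast
qed

text \<open>Induction on the absolute value of the entry sum, an integer that the floor turns into a
  natural-number measure. A generator that lowers it is an involution, so it can be moved back and
  absorbed into the left factor. The terminal cases are the matrices with all row sums 1 or all
  -1.\<close>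

lemma Aut_QD_factor:
  assumes "U \<in> Aut_QD"
  shows "\<exists>h\<in>super_apollonian. \<exists>f\<in>perm_sign_group. U = h ** f"
  using assms
proof (induction "nat \<bar>\<lfloor>\<Sum>k\<in>UNIV. \<Sum>j\<in>UNIV. U $ k $ j\<rfloor>\<bar>" arbitrary: U rule: less_induct)
  case less
  have form: "transpose U ** Q_D ** U = Q_D" and "int_mat U" using less(2) by (auto simp: Aut_QD_def)
  then obtain u where u: "U = (\<chi> i j. of_int (u i j))" using int_matE by blast
  define v where "v k = (\<Sum>j\<in>UNIV. u k j)" for k
  have vU: "(\<Sum>j\<in>UNIV. U $ k $ j) = of_int (v k)" for k by (simp add: u v_def)
  have floor: "\<lfloor>\<Sum>k\<in>UNIV. \<Sum>j\<in>UNIV. U $ k $ j\<rfloor> = (\<Sum>k\<in>UNIV. v k)"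
    unfolding vU by (simp flip: of_int_sum)
  have one: "mat 1 \<in> super_apollonian" using subgroup.one_closed[OF subgroup_super_apollonian] by simp
  have step: ?case
    if S: "S \<in> super_apollonian" "S ** S = mat 1"
      and sum: "(\<Sum>k\<in>UNIV. \<Sum>j\<in>UNIV. (S ** U) $ k $ j) = of_int s"
      and less': "\<bar>s\<bar> < \<bar>\<Sum>k\<in>UNIV. v k\<bar>" for S s
  proof -
    have "S ** U \<in> Aut_QD"
      using subgroup.m_closed[OF subgroup_Aut_QD, of S U] S less(2) super_apollonian_subset by auto
    moreover have "nat \<bar>\<lfloor>\<Sum>k\<in>UNIV. \<Sum>j\<in>UNIV. (S ** U) $ k $ j\<rfloor>\<bar>
        < nat \<bar>\<lfloor>\<Sum>k\<in>UNIV. \<Sum>j\<in>UNIV. U $ k $ j\<rfloor>\<bar>"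
      unfolding floor sum using less' by simp
    ultimately obtain h f where h: "h \<in> super_apollonian" "f \<in> perm_sign_group" "S ** U = h ** f"
      using less(1) by blast
    have "U = S ** (S ** U)" using S(2) by (simp add: matrix_mul_assoc)
    also have "\<dots> = (S ** h) ** f" using h(3) by (simp add: matrix_mul_assoc)
    finally show ?thesis
      using subgroup.m_closed[OF subgroup_super_apollonian, of S h] S h by auto
  qed
  show ?case
  proof (rule descent[of v])
    show "odd (v k)" for k unfolding v_def by (rule odd_row_sum[OF u form])
    show "2 * (\<Sum>k\<in>UNIV. (v k)\<^sup>2) = (\<Sum>k\<in>UNIV. v k)\<^sup>2 - 8"
      unfolding v_def by (rule row_sum_form_int[OF u form])
  next
    assume "\<And>k. v k = 1"
    then have "U \<in> perm_mats" using Aut_QD_row_sums_one[OF less(2)] vU by simp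
    then show ?thesis using one by (intro bexI[of _ "mat 1"] bexI[of _ U]) (simp_all add: perm_sign_group_eq)
  next
    assume "\<And>k. v k = -1"
    then have "(\<Sum>j\<in>UNIV. (- U) $ k $ j) = 1" for k using vU[of k] by (simp add: sum_negf)
    then have "- U \<in> perm_mats" using Aut_QD_row_sums_one minus_in_Aut_QD[OF less(2)] by blast
    then have "U \<in> uminus ` perm_mats" by (metis image_eqI minus_minus)
    then show ?thesis using one by (intro bexI[of _ "mat 1"] bexI[of _ U]) (simp_all add: perm_sign_group_eq)
  next
    fix k assume lt: "\<bar>3 * (\<Sum>k\<in>UNIV. v k) - 4 * v k\<bar> < \<bar>\<Sum>k\<in>UNIV. v k\<bar>"
    have "(\<Sum>i\<in>UNIV. \<Sum>j\<in>UNIV. (S_mat k ** U) $ i $ j) = of_int (3 * (\<Sum>k\<in>UNIV. v k) - 4 * v k)"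
      unfolding S_mat_mult v_def u using exhaust_4[of k] by (auto simp: sum_4)
    then show ?thesis using step[OF S_mat_in_super_apollonian S_mat_squared] lt by blast
  next
    fix k assume lt: "\<bar>(\<Sum>k\<in>UNIV. v k) + 4 * v k\<bar> < \<bar>\<Sum>k\<in>UNIV. v k\<bar>"
    have "(\<Sum>i\<in>UNIV. \<Sum>j\<in>UNIV. (transpose (S_mat k) ** U) $ i $ j) = of_int ((\<Sum>k\<in>UNIV. v k) + 4 * v k)"
      unfolding transpose_S_mat_mult v_def u using exhaust_4[of k] by (auto simp: sum_4)
    then show ?thesis
      using step[OF transpose_S_mat_in_super_apollonian transpose_S_mat_squared] lt by blast
  qed
qed

section \<open>A congruence modulo 4\<close>

text \<open>Modulo 4 the super-Apollonian group is an elementary abelian 2-group: \<open>S_mat k\<close> adds \<open>2\<close> to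
  row \<open>k\<close> of the identity, and its transpose adds \<open>2\<close> to column \<open>k\<close>.\<close>

definition rank_one_mod4 :: "mat4 \<Rightarrow> bool" where
  "rank_one_mod4 U \<longleftrightarrow> (\<exists>(a :: 4 \<Rightarrow> int) b c.
     U = (\<chi> i j. of_int ((if i = j then 1 else 0) + 2 * (a i + b j) + 4 * c i j)))"

text \<open>Write the factors as \<open>I + 2 y\<close> and \<open>I + 2 y'\<close>. Their product
  is \<open>I + 2 (y + y') + 4 y y'\<close>, so modulo 4 the vectors \<open>a\<close> and
  \<open>b\<close> simply add up.\<close>

lemma rank_one_mod4_mult:
  assumes "rank_one_mod4 U" "rank_one_mod4 V"
  shows "rank_one_mod4 (U ** V)"
proof -
  obtain a b c where U: "U = (\<chi> i j. of_int ((if i = j then 1 else 0) + 2 * (a i + b j) + 4 * c i j))"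
    using assms(1) unfolding rank_one_mod4_def by blast
  obtain a' b' c' where V: "V = (\<chi> i j. of_int ((if i = j then 1 else 0) + 2 * (a' i + b' j) + 4 * c' i j))"
    using assms(2) unfolding rank_one_mod4_def by blast
  define y where "y i j = a i + b j + 2 * c i j" for i j
  define y' where "y' i j = a' i + b' j + 2 * c' i j" for i j
  have U': "U = (\<chi> i j. of_int ((if i = j then 1 else 0) + 2 * y i j))"
    by (simp add: U y_def algebra_simps)
  have V': "V = (\<chi> i j. of_int ((if i = j then 1 else 0) + 2 * y' i j))"
    by (simp add: V y'_def algebra_simps)
  have "(U ** V) $ i $ j = of_int ((if i = j then 1 else 0)
      + 2 * ((a i + a' i) + (b j + b' j)) + 4 * (c i j + c' i j + (\<Sum>k\<in>UNIV. y i k * y' k j)))" for i j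
  proof -
    let ?d = "\<lambda>i j. if i = j then 1 else (0 :: int)"
    have "(U ** V) $ i $ j = of_int (\<Sum>k\<in>UNIV. (?d i k + 2 * y i k) * (?d k j + 2 * y' k j))"
      unfolding matrix_matrix_mult_def U' V' vec_lambda_beta by (simp only: of_int_sum of_int_mult)
    also have "(\<Sum>k\<in>UNIV. (?d i k + 2 * y i k) * (?d k j + 2 * y' k j))
        = (\<Sum>k\<in>UNIV. (if i = k then ?d k j + 2 * y' k j else 0)
            + (if j = k then 2 * y i k else 0) + 4 * (y i k * y' k j))"
      by (rule sum.cong) (auto simp: algebra_simps)
    also have "\<dots> = ?d i j + 2 * y' i j + 2 * y i j + 4 * (\<Sum>k\<in>UNIV. y i k * y' k j)"
      by (simp add: sum.distrib sum_distrib_left)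
    finally show ?thesis by (simp add: y_def y'_def algebra_simps)
  qed
  then show ?thesis
    unfolding rank_one_mod4_def
    by (intro exI[of _ "\<lambda>i. a i + a' i"] exI[of _ "\<lambda>j. b j + b' j"]
        exI[of _ "\<lambda>i j. c i j + c' i j + (\<Sum>k\<in>UNIV. y i k * y' k j)"]) (simp add: vec_eq_iff)
qed

lemma rank_one_mod4_S_mat: "rank_one_mod4 (S_mat k)"
  unfolding rank_one_mod4_def
  \<comment> \<open>The diagonal entry at \<open>k\<close> is \<open>-1 = 1 + 2 - 4\<close>, which
    accounts for the correction term.\<close>
  by (intro exI[of _ "\<lambda>i. if i = k then 1 else 0"] exI[of _ "\<lambda>_. 0"]
      exI[of _ "\<lambda>i j. if i = k \<and> j = k then -1 else 0"]) (auto simp: vec_eq_iff S_mat_def)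

lemma rank_one_mod4_transpose_S_mat: "rank_one_mod4 (transpose (S_mat k))"
  unfolding rank_one_mod4_def
  by (intro exI[of _ "\<lambda>_. 0"] exI[of _ "\<lambda>i. if i = k then 1 else 0"]
      exI[of _ "\<lambda>i j. if i = k \<and> j = k then -1 else 0"]) (auto simp: vec_eq_iff S_mat_def transpose_def)

lemma super_apollonian_mod4:
  assumes "U \<in> super_apollonian"
  shows "rank_one_mod4 U"
  using assms unfolding super_apollonian_def
proof (induction rule: mgen_induct)
  case (invertible a)
  then show ?case by (rule apollonian_gens_invertible)
next
  case one
  show ?case
    unfolding rank_one_mod4_def
    by (intro exI[of _ "\<lambda>_. 0"] exI[of _ "\<lambda>_ _. 0"]) (simp add: vec_eq_iff mat_def)
next
  case (gen a)
  then show ?case using rank_one_mod4_S_mat rank_one_mod4_transpose_S_mat by auto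
next
  case (inverse a b)
  have "a ** a = mat 1" using inverse(1) S_mat_squared transpose_S_mat_squared by auto
  then have "b = a" using inv_GL4[OF inverse(2)] inv_GL4[of a a] by simp
  then show ?case using inverse(1) rank_one_mod4_S_mat rank_one_mod4_transpose_S_mat by auto
next
  case (mult a b)
  then show ?case by (rule rank_one_mod4_mult)
qed

lemma super_apollonian_Int_perm_sign_group:
  assumes "U \<in> super_apollonian" "U \<in> perm_sign_group"
  shows "U = mat 1"
proof -
  obtain a b c where U: "U = (\<chi> i j. of_int ((if i = j then 1 else 0) + 2 * (a i + b j) + 4 * c i j))"
    using super_apollonian_mod4[OF assms(1)] unfolding rank_one_mod4_def by blast
  obtain p s where s: "s = 1 \<or> s = -1" and p: "\<And>i j. U $ i $ j = of_int (if p i = j then s else 0)"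
  proof (rule perm_sign_group_cases[OF assms(2)])
    fix q assume "U = perm_mat q"
    then show thesis by (intro that[of 1 q]) (auto simp: perm_mat_def)
  next
    fix q assume "U = - perm_mat q"
    then show thesis by (intro that[of "-1" q]) (auto simp: perm_mat_def)
  qed
  have ent: "(if p i = j then s else 0) = (if i = j then 1 else 0) + 2 * (a i + b j) + 4 * c i j" for i j
    using p[of i j] unfolding U vec_lambda_beta by (simp only: of_int_eq_iff)
  \<comment> \<open>By the congruence the diagonal entry is odd, hence nonzero, so \<open>p\<close>
    fixes \<open>i\<close>.\<close>
  have id: "p i = i" for i using ent[of i i] by (auto split: if_splits) presburger
  have "s = 1"
  proof (rule ccontr)
    assume "s \<noteq> 1"
    then have "s = -1" using s by simp
    \<comment> \<open>With \<open>s = -1\<close> the diagonal makes \<open>a 1 + b 1\<close> odd,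
      whereas the off-diagonal zeros make \<open>a 1 + b 2\<close>, \<open>a 3 + b 2\<close> and
      \<open>a 3 + b 1\<close> even; the alternating sum of these three is
      \<open>a 1 + b 1\<close>.\<close>
    then show False
      using ent[of 1 1] ent[of 1 2] ent[of 3 2] ent[of 3 1] by (simp add: id) presburger
  qed
  then show ?thesis using p id by (simp add: vec_eq_iff mat_def)
qed

section \<open>Normality\<close>

text \<open>Stating the action on generators as \<open>f ** a = b ** f\<close> avoids computing
  inverses; \<open>conj_generate\<close> extends it to the whole group.\<close>

lemma conj_super_apollonian:
  assumes f: "invertible f" and ex: "\<And>a. a \<in> apollonian_gens \<Longrightarrow> \<exists>b\<in>apollonian_gens. f ** a = b ** f"
    and y: "y \<in> super_apollonian"
  shows "f \<otimes>\<^bsub>GL4\<^esub> y \<otimes>\<^bsub>GL4\<^esub> inv\<^bsub>GL4\<^esub> f \<in> super_apollonian"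
  using y unfolding super_apollonian_def mgen_def
proof (rule GL4.conj_generate[rotated 3])
  show "apollonian_gens \<subseteq> carrier GL4" using apollonian_gens_invertible by auto
  show "f \<in> carrier GL4" using f by simp
  fix a assume "a \<in> apollonian_gens"
  then obtain b where b: "b \<in> apollonian_gens" "f ** a = b ** f" using ex by blast
  have "f \<otimes>\<^bsub>GL4\<^esub> a \<otimes>\<^bsub>GL4\<^esub> inv\<^bsub>GL4\<^esub> f = b \<otimes>\<^bsub>GL4\<^esub> (f \<otimes>\<^bsub>GL4\<^esub> inv\<^bsub>GL4\<^esub> f)"
    using b(2) by (simp add: matrix_mul_assoc)
  also have "\<dots> = b" using GL4.r_inv[of f] f by simp
  finally show "f \<otimes>\<^bsub>GL4\<^esub> a \<otimes>\<^bsub>GL4\<^esub> inv\<^bsub>GL4\<^esub> f \<in> generate GL4 apollonian_gens"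
    using b(1) by (simp add: generate.incl)
qed

lemma perm_sign_group_conj:
  assumes f: "f \<in> perm_sign_group" and y: "y \<in> super_apollonian"
  shows "f \<otimes>\<^bsub>GL4\<^esub> y \<otimes>\<^bsub>GL4\<^esub> inv\<^bsub>GL4\<^esub> f \<in> super_apollonian"
proof (rule conj_super_apollonian[OF _ _ y])
  show "invertible f" using f subgroup.subset[OF subgroup_perm_sign_group] by auto
  fix a assume "a \<in> apollonian_gens"
  then obtain k where "a = S_mat k \<or> a = transpose (S_mat k)" by auto
  moreover from f obtain p where "p permutes UNIV" "f = perm_mat p \<or> f = - perm_mat p"
    by (rule perm_sign_group_cases) auto
  ultimately show "\<exists>b\<in>apollonian_gens. f ** a = b ** f"
    by (auto simp: perm_mat_S_mat perm_mat_transpose_S_mat minus_mult mult_minus)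
qed

section \<open>The half-integral involution \<open>D_mat\<close>\<close>

lemma D_mat_eq: "D_mat = - Q_D"
  by (simp add: D_mat_def vec_eq_iff Q_D_nth forall_4 vector_def)

lemma D_mat_squared: "D_mat ** D_mat = mat 1"
  by (simp add: D_mat_eq minus_mult mult_minus Q_D_squared)

lemma D_mat_notin_Aut_QD: "D_mat \<notin> Aut_QD"
proof
  assume "D_mat \<in> Aut_QD"
  then have "D_mat $ 1 $ 1 \<in> \<int>" by (simp add: Aut_QD_def int_mat_def)
  then obtain n where "- (1 / 2) = real_of_int n" by (auto simp: D_mat_eq Q_D_nth Ints_def)
  then have "real_of_int (2 * n) = real_of_int (-1)" by simp
  then have "2 * n = -1" by (simp only: of_int_eq_iff)
  then show False by presburger
qed

lemma invertible_D_mat: "invertible D_mat"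
  using D_mat_squared unfolding invertible_def by blast

lemma D_mat_conj:
  assumes y: "y \<in> super_apollonian"
  shows "D_mat \<otimes>\<^bsub>GL4\<^esub> y \<otimes>\<^bsub>GL4\<^esub> inv\<^bsub>GL4\<^esub> D_mat \<in> super_apollonian"
proof (rule conj_super_apollonian[OF invertible_D_mat _ y])
  fix a assume "a \<in> apollonian_gens"
  then obtain k where "a = S_mat k \<or> a = transpose (S_mat k)" by auto
  then show "\<exists>b\<in>apollonian_gens. D_mat ** a = b ** D_mat"
    by (auto simp: D_mat_eq minus_mult mult_minus transpose_Q_D_S_mat[symmetric] S_mat_Q_D[symmetric])
qed

section \<open>The Lorentz form\<close>

lemma Q_L_nth: "Q_L $ i $ j = (if i = j then if i = 1 then -1 else 1 else 0)"
  using exhaust_4[of i] exhaust_4[of j] by (auto simp: Q_L_def vector_def)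

text \<open>Splitting off the common 1/2 leaves an integral part, on which the computation modulo 4
  in \<open>J0_conj_mod4\<close> rests.\<close>

lemma J0_nth: "J0 $ i $ j = 1 / 2 - of_int (if i \<noteq> 1 \<and> j \<noteq> 1 \<and> i \<noteq> j then 1 else 0)"
  using exhaust_4[of i] exhaust_4[of j] by (auto simp: J0_def vector_def)

lemma J0_squared: "J0 ** J0 = mat 1"
  by (simp add: vec_eq_iff forall_4 matrix_matrix_mult_def sum_4 J0_nth mat_def)

lemma transpose_J0: "transpose J0 = J0"
  by (auto simp: vec_eq_iff transpose_def J0_nth)

lemma Q_L_squared: "Q_L ** Q_L = mat 1"
  by (simp add: vec_eq_iff forall_4 matrix_matrix_mult_def sum_4 Q_L_nth mat_def)

lemma transpose_Q_L: "transpose Q_L = Q_L"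
  by (auto simp: vec_eq_iff transpose_def Q_L_nth)

text \<open>\<open>J0\<close> is a symmetric involution, so this change of basis of a form is also a
  conjugation; it identifies the Descartes form with the Lorentz form.\<close>

lemma J0_Q_D: "J0 ** Q_D ** J0 = Q_L"
  by (simp add: vec_eq_iff forall_4 matrix_matrix_mult_def sum_4 J0_nth Q_D_nth Q_L_nth)

lemma J0_Q_L: "J0 ** Q_L ** J0 = Q_D"
proof -
  have "J0 ** Q_L ** J0 = (J0 ** J0) ** Q_D ** (J0 ** J0)"
    unfolding J0_Q_D[symmetric] by (simp only: matrix_mul_assoc)
  then show ?thesis by (simp add: J0_squared)
qed

lemma J0_conj_conj: "J0 ** (J0 ** M ** J0) ** J0 = M"
proof -
  have "J0 ** (J0 ** M ** J0) ** J0 = (J0 ** J0) ** M ** (J0 ** J0)" by (simp only: matrix_mul_assoc)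
  then show ?thesis by (simp add: J0_squared)
qed

lemma J0_conj_mult: "(J0 ** M ** J0) ** (J0 ** N ** J0) = J0 ** (M ** N) ** J0"
proof -
  have "(J0 ** M ** J0) ** (J0 ** N ** J0) = J0 ** M ** (J0 ** J0) ** N ** J0"
    by (simp only: matrix_mul_assoc)
  then show ?thesis by (simp add: J0_squared matrix_mul_assoc)
qed

lemma J0_conj_form:
  assumes "transpose M ** P ** M = P"
  shows "transpose (J0 ** M ** J0) ** (J0 ** P ** J0) ** (J0 ** M ** J0) = J0 ** P ** J0"
proof -
  have "transpose (J0 ** M ** J0) = J0 ** transpose M ** J0"
    by (simp add: matrix_transpose_mul transpose_J0 matrix_mul_assoc)
  then show ?thesis by (simp only: J0_conj_mult assms)
qed

lemma subgroup_O31Z: "subgroup O31Z GL4"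
  unfolding O31Z_def
proof (rule subgroup_form[OF Q_L_squared transpose_Q_L])
  have "int_mat Q_L" by (auto simp: int_mat_def Q_L_nth)
  then show "int_mat (Q_L ** transpose U ** Q_L)" if "int_mat U" for U
    using that by (intro int_mat_mult int_mat_transpose)
qed

lemma matrix_inv_J0: "matrix_inv J0 = J0"
proof -
  have "J0 ** matrix_inv J0 = mat 1 \<and> matrix_inv J0 ** J0 = mat 1"
    \<comment> \<open>\<open>matrix_inv\<close> chooses some two-sided inverse, and
      \<open>J0\<close> witnesses that one exists.\<close>
    unfolding matrix_inv_def by (rule someI[of _ J0]) (simp add: J0_squared)
  then have "J0 ** (J0 ** matrix_inv J0) = J0" by simp
  then show ?thesis by (simp add: matrix_mul_assoc J0_squared)
qed

lemma G_grp_iff: "M \<in> G_grp \<longleftrightarrow> J0 ** M ** J0 \<in> O31Z"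
  unfolding G_grp_def matrix_inv_J0 using J0_conj_conj by (auto intro: sym)

lemma subgroup_G_grp: "subgroup G_grp GL4"
proof (rule GL4.subgroupI)
  have inv: "M ** (J0 ** N ** J0) = mat 1" if "(J0 ** M ** J0) ** N = mat 1" for M N
  proof -
    have "M ** (J0 ** N ** J0) = J0 ** ((J0 ** M ** J0) ** N) ** J0"
      by (simp add: matrix_mul_assoc J0_squared)
    then show ?thesis using that by (simp add: J0_squared)
  qed
  have ex: "\<exists>N\<in>O31Z. M ** (J0 ** N ** J0) = mat 1" if "M \<in> G_grp" for M
  proof -
    have O: "J0 ** M ** J0 \<in> O31Z" using that G_grp_iff by simp
    then have "J0 ** M ** J0 \<in> carrier GL4" using subgroup.subset[OF subgroup_O31Z] by blast
    then have "(J0 ** M ** J0) ** inv\<^bsub>GL4\<^esub> (J0 ** M ** J0) = mat 1" using GL4.r_inv by simp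
    then show ?thesis using inv subgroup.m_inv_closed[OF subgroup_O31Z O] by blast
  qed
  show "G_grp \<subseteq> carrier GL4"
    using ex matrix_left_right_inverse by (fastforce simp: invertible_def)
  show "inv\<^bsub>GL4\<^esub> M \<in> G_grp" if "M \<in> G_grp" for M
    using ex[OF that] inv_GL4 by (auto simp: G_grp_iff J0_conj_conj)
  show "M \<otimes>\<^bsub>GL4\<^esub> N \<in> G_grp" if "M \<in> G_grp" "N \<in> G_grp" for M N
    using that subgroup.m_closed[OF subgroup_O31Z, of "J0 ** M ** J0" "J0 ** N ** J0"]
    by (simp add: G_grp_iff J0_conj_mult)
  have "mat 1 \<in> G_grp"
    using subgroup.one_closed[OF subgroup_O31Z] by (simp add: G_grp_iff J0_squared)
  then show "G_grp \<noteq> {}" by blast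
qed

text \<open>The entries of \<open>2 J0\<close> are \<open>1 - 2 * e i j\<close>. Expanding, four
  times an entry is the total of \<open>u\<close>, minus twice the row and column sums weighted by
  \<open>e\<close>, plus a multiple of 4. Each row and column of \<open>e\<close> has no 1 or
  exactly two, so these weighted sums of odd numbers are even, and the residue is the same for all
  \<open>i\<close> and \<open>j\<close>.\<close>

lemma J0_conj_mod4:
  fixes u :: "4 \<Rightarrow> 4 \<Rightarrow> int"
  assumes U: "U = (\<chi> i j. of_int (u i j))"
    and rows: "\<And>k. odd (\<Sum>l\<in>UNIV. u k l)" and cols: "\<And>l. odd (\<Sum>k\<in>UNIV. u k l)"
  obtains c :: int where "4 * (J0 ** U ** J0) $ i $ j = of_int ((\<Sum>k\<in>UNIV. \<Sum>l\<in>UNIV. u k l) + 4 * c)"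
proof -
  define e :: "4 \<Rightarrow> 4 \<Rightarrow> int" where "e i j = (if i \<noteq> 1 \<and> j \<noteq> 1 \<and> i \<noteq> j then 1 else 0)" for i j
  define r where "r k = (\<Sum>l\<in>UNIV. u k l)" for k
  define s where "s l = (\<Sum>k\<in>UNIV. u k l)" for l
  define d where "d i j = 1 - 2 * e i j" for i j
  have J: "J0 $ i $ j = of_int (d i j) / 2" for i j by (simp add: J0_nth d_def e_def)
  have odd: "odd (r k)" "odd (s k)" for k using rows cols by (simp_all add: r_def s_def)
  have "even (\<Sum>k\<in>UNIV. e i k * r k)"
    using exhaust_4[of i] odd by (auto simp: sum_4 e_def)
  then obtain x where x: "(\<Sum>k\<in>UNIV. e i k * r k) = 2 * x" by blast
  have "even (\<Sum>l\<in>UNIV. s l * e l j)"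
    using exhaust_4[of j] odd by (auto simp: sum_4 e_def)
  then obtain y where y: "(\<Sum>l\<in>UNIV. s l * e l j) = 2 * y" by blast
  let ?z = "\<Sum>k\<in>UNIV. \<Sum>l\<in>UNIV. e i k * u k l * e l j"
  have "4 * (J0 ** U ** J0) $ i $ j = of_int (\<Sum>l\<in>UNIV. (\<Sum>k\<in>UNIV. d i k * u k l) * d l j)"
    unfolding matrix_matrix_mult_def J U vec_lambda_beta
    by (simp add: sum_divide_distrib[symmetric])
  also have "(\<Sum>l\<in>UNIV. (\<Sum>k\<in>UNIV. d i k * u k l) * d l j) = (\<Sum>k\<in>UNIV. \<Sum>l\<in>UNIV. u k l)
      - 2 * (\<Sum>k\<in>UNIV. e i k * r k) - 2 * (\<Sum>l\<in>UNIV. s l * e l j) + 4 * ?z"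
    unfolding d_def r_def s_def sum_4 by algebra
  also have "of_int \<dots> = of_int ((\<Sum>k\<in>UNIV. \<Sum>l\<in>UNIV. u k l) + 4 * (?z - x - y))"
    unfolding x y by (simp add: algebra_simps)
  finally show ?thesis by (rule that)
qed

lemma J0_conj_int:
  fixes u :: "4 \<Rightarrow> 4 \<Rightarrow> int"
  assumes "U = (\<chi> i j. of_int (u i j))"
    and "\<And>k. odd (\<Sum>l\<in>UNIV. u k l)" "\<And>l. odd (\<Sum>k\<in>UNIV. u k l)"
    and total: "4 dvd (\<Sum>k\<in>UNIV. \<Sum>l\<in>UNIV. u k l)"
  shows "int_mat (J0 ** U ** J0)"
  unfolding int_mat_def
proof (intro allI)
  fix i j
  obtain t where t: "(\<Sum>k\<in>UNIV. \<Sum>l\<in>UNIV. u k l) = 4 * t" using total by blast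
  obtain c where "4 * (J0 ** U ** J0) $ i $ j = of_int ((\<Sum>k\<in>UNIV. \<Sum>l\<in>UNIV. u k l) + 4 * c)"
    using J0_conj_mod4[OF assms(1-3)] .
  then have "(J0 ** U ** J0) $ i $ j = of_int (t + c)" unfolding t by simp
  then show "(J0 ** U ** J0) $ i $ j \<in> \<int>" by (metis Ints_of_int)
qed

section \<open>Comparison of \<open>Aut_QD\<close> with \<open>G_grp\<close>\<close>

lemma Aut_QD_subset_G_grp: "Aut_QD \<subseteq> G_grp"
proof
  fix U assume "U \<in> Aut_QD"
  then have form: "transpose U ** Q_D ** U = Q_D" and "int_mat U" by (auto simp: Aut_QD_def)
  then obtain u where u: "U = (\<chi> i j. of_int (u i j))" using int_matE by blast
  have "int_mat (J0 ** U ** J0)"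
    by (rule J0_conj_int[OF u]) (rule odd_row_sum[OF u form] odd_col_sum[OF u form] Aut_QD_total[OF u form])+
  then show "U \<in> G_grp"
    using J0_conj_form[OF form] by (simp add: G_grp_iff O31Z_def J0_Q_D)
qed

lemma form_Q_L:
  "(transpose M ** Q_L ** M) $ j $ j = - (M $ 1 $ j)\<^sup>2 + (M $ 2 $ j)\<^sup>2 + (M $ 3 $ j)\<^sup>2 + (M $ 4 $ j)\<^sup>2"
  by (simp add: matrix_matrix_mult_def transpose_def sum_4 Q_L_nth power2_eq_square)

lemma odd_col_sum_O31Z:
  fixes m :: "4 \<Rightarrow> 4 \<Rightarrow> int"
  assumes M: "M = (\<chi> i j. of_int (m i j))" and form: "transpose M ** Q_L ** M = Q_L"
  shows "odd (\<Sum>k\<in>UNIV. m k j)"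
proof -
  have "- (M $ 1 $ j)\<^sup>2 + (M $ 2 $ j)\<^sup>2 + (M $ 3 $ j)\<^sup>2 + (M $ 4 $ j)\<^sup>2 = (if j = 1 then -1 else 1)"
    using form_Q_L[of M j] form by (simp add: Q_L_nth)
  then have "real_of_int (- (m 1 j)\<^sup>2 + (m 2 j)\<^sup>2 + (m 3 j)\<^sup>2 + (m 4 j)\<^sup>2) = of_int (if j = 1 then -1 else 1)"
    by (simp add: M)
  then have "- (m 1 j)\<^sup>2 + (m 2 j)\<^sup>2 + (m 3 j)\<^sup>2 + (m 4 j)\<^sup>2 = (if j = 1 then -1 else 1)"
    by (simp only: of_int_eq_iff)
  then have "odd (- (m 1 j)\<^sup>2 + (m 2 j)\<^sup>2 + (m 3 j)\<^sup>2 + (m 4 j)\<^sup>2)" by simp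
  then show ?thesis by (simp add: sum_4) blast
qed

lemma odd_row_sum_O31Z:
  fixes m :: "4 \<Rightarrow> 4 \<Rightarrow> int"
  assumes M: "M = (\<chi> i j. of_int (m i j))" and form: "transpose M ** Q_L ** M = Q_L"
  shows "odd (\<Sum>k\<in>UNIV. m i k)"
  using odd_col_sum_O31Z[of "transpose M" "\<lambda>i j. m j i"] form_inverse(2)[OF Q_L_squared form]
  by (simp add: M transpose_def)

lemma J0_conj_O31Z:
  assumes M: "M = (\<chi> i j. of_int (m i j))" "M \<in> O31Z" and total: "4 dvd (\<Sum>k\<in>UNIV. \<Sum>l\<in>UNIV. m k l)"
  shows "J0 ** M ** J0 \<in> Aut_QD"
proof -
  have form: "transpose M ** Q_L ** M = Q_L" using M(2) by (simp add: O31Z_def)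
  have "int_mat (J0 ** M ** J0)"
    by (rule J0_conj_int[OF M(1)]) (rule odd_row_sum_O31Z[OF M(1) form] odd_col_sum_O31Z[OF M(1) form] total)+
  then show ?thesis using J0_conj_form[OF form] by (simp add: Aut_QD_def J0_Q_L)
qed

lemma G_grp_cases:
  assumes "U \<in> G_grp"
  shows "U \<in> Aut_QD \<or> D_mat ** U \<in> Aut_QD"
proof -
  define M where "M = J0 ** U ** J0"
  have M: "M \<in> O31Z" using assms by (simp add: M_def G_grp_iff)
  then have form: "transpose M ** Q_L ** M = Q_L" and "int_mat M" by (auto simp: O31Z_def)
  then obtain m where m: "M = (\<chi> i j. of_int (m i j))" using int_matE by blast
  define r where "r k = (\<Sum>l\<in>UNIV. m k l)" for k
  have odd: "odd (r k)" for k unfolding r_def by (rule odd_row_sum_O31Z[OF m form])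
  have tot: "(\<Sum>k\<in>UNIV. \<Sum>l\<in>UNIV. m k l) = r 1 + r 2 + r 3 + r 4" by (simp add: sum_4 r_def)
  show ?thesis
  proof (cases "4 dvd r 1 + r 2 + r 3 + r 4")
    case True
    then show ?thesis using J0_conj_O31Z[OF m M] tot by (simp add: M_def J0_conj_conj)
  next
    case False
    \<comment> \<open>Multiplying by \<open>- Q_L\<close>, the conjugate of \<open>D_mat\<close> by
      \<open>J0\<close>, negates rows 2 to 4. This changes the total by twice a sum of three odd
      numbers, that is, by 2 modulo 4, so an even total not divisible by 4 becomes divisible by
      4.\<close>
    define m' where "m' k l = (if k = 1 then m k l else - m k l)" for k l
    have m': "- Q_L ** M = (\<chi> i j. of_int (m' i j))"
      using exhaust_4 by (auto simp: vec_eq_iff matrix_matrix_mult_def sum_4 Q_L_nth m m'_def)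
    have tQ: "transpose (- Q_L) = - Q_L" using transpose_Q_L by (simp add: vec_eq_iff transpose_def)
    have "- Q_L \<in> O31Z"
      by (auto simp: O31Z_def int_mat_def Q_L_nth tQ minus_mult mult_minus Q_L_squared)
    then have O: "- Q_L ** M \<in> O31Z"
      using subgroup.m_closed[OF subgroup_O31Z, of "- Q_L" M] M by simp
    have "(\<Sum>k\<in>UNIV. \<Sum>l\<in>UNIV. m' k l) = r 1 - r 2 - r 3 - r 4" by (simp add: sum_4 r_def m'_def)
    moreover have "4 dvd r 1 - r 2 - r 3 - r 4"
    proof -
      obtain a b c d where "r 1 = 2 * a + 1" "r 2 = 2 * b + 1" "r 3 = 2 * c + 1" "r 4 = 2 * d + 1"
        using odd by (meson oddE)
      then show ?thesis using False by presburger
    qed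
    ultimately have "J0 ** (- Q_L ** M) ** J0 \<in> Aut_QD" using J0_conj_O31Z[OF m' O] by simp
    moreover have "J0 ** (- Q_L ** M) ** J0 = D_mat ** U"
    proof -
      have "J0 ** (- Q_L ** M) ** J0 = - (J0 ** Q_L ** (J0 ** U ** J0) ** J0)"
        unfolding M_def by (simp add: minus_mult mult_minus matrix_mul_assoc)
      also have "\<dots> = - ((J0 ** Q_L ** J0) ** U ** (J0 ** J0))" by (simp add: matrix_mul_assoc)
      also have "\<dots> = D_mat ** U" by (simp add: J0_Q_L J0_squared D_mat_eq minus_mult)
      finally show ?thesis .
    qed
    ultimately show ?thesis by simp
  qed
qed

text \<open>The total of four odd row sums is even, so \<open>J0_conj_mod4\<close> makes four times
  the entry an even integer.\<close>

lemma G_grp_half_integral: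
  assumes "U \<in> G_grp"
  shows "2 * U $ i $ j \<in> \<int>"
proof -
  define M where "M = J0 ** U ** J0"
  have "M \<in> O31Z" using assms by (simp add: M_def G_grp_iff)
  then have form: "transpose M ** Q_L ** M = Q_L" and "int_mat M" by (auto simp: O31Z_def)
  then obtain m where m: "M = (\<chi> i j. of_int (m i j))" using int_matE by blast
  have odd: "odd (\<Sum>l\<in>UNIV. m k l)" "odd (\<Sum>k\<in>UNIV. m k l)" for k l
    by (rule odd_row_sum_O31Z[OF m form], rule odd_col_sum_O31Z[OF m form])
  have "even (\<Sum>k\<in>UNIV. \<Sum>l\<in>UNIV. m k l)"
    using odd(1)[of 1] odd(1)[of 2] odd(1)[of 3] odd(1)[of 4] unfolding sum_4[of "\<lambda>k. \<Sum>l\<in>UNIV. m k l"]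
    by presburger
  then obtain t where t: "(\<Sum>k\<in>UNIV. \<Sum>l\<in>UNIV. m k l) = 2 * t" by blast
  obtain c where "4 * (J0 ** M ** J0) $ i $ j = of_int ((\<Sum>k\<in>UNIV. \<Sum>l\<in>UNIV. m k l) + 4 * c)"
    using J0_conj_mod4[OF m odd] .
  then have "2 * U $ i $ j = of_int (t + 2 * c)" unfolding t M_def J0_conj_conj by simp
  then show ?thesis by (metis Ints_of_int)
qed

lemma D_mat_in_G_grp: "D_mat \<in> G_grp"
proof -
  have "J0 ** D_mat ** J0 = - Q_L" by (simp add: D_mat_eq minus_mult mult_minus J0_Q_D)
  moreover have "transpose (- Q_L) = - Q_L" using transpose_Q_L by (simp add: vec_eq_iff transpose_def)
  ultimately show ?thesis
    by (auto simp: G_grp_iff O31Z_def int_mat_def Q_L_nth minus_mult mult_minus Q_L_squared)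
qed

section \<open>Indices\<close>

text \<open>The quotient of \<open>f\<close> by \<open>g\<close> lies in both groups, whose
  intersection is trivial.\<close>

lemma perm_sign_group_uniq:
  assumes f: "f \<in> perm_sign_group" and g: "g \<in> perm_sign_group"
    and fg: "f \<otimes>\<^bsub>GL4\<^esub> inv\<^bsub>GL4\<^esub> g \<in> super_apollonian"
  shows "f = g"
proof -
  have carr: "f \<in> carrier GL4" "g \<in> carrier GL4"
    using f g subgroup.subset[OF subgroup_perm_sign_group] by auto
  have "f \<otimes>\<^bsub>GL4\<^esub> inv\<^bsub>GL4\<^esub> g \<in> perm_sign_group"
    using subgroup_perm_sign_group f g by (intro subgroup.m_closed subgroup.m_inv_closed)
  then have "f \<otimes>\<^bsub>GL4\<^esub> inv\<^bsub>GL4\<^esub> g = \<one>\<^bsub>GL4\<^esub>"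
    using super_apollonian_Int_perm_sign_group[OF fg] by simp
  then show ?thesis using carr GL4.inv_equality GL4.inv_closed GL4.inv_inv by metis
qed

lemma super_apollonian_Aut_QD:
  "super_apollonian \<lhd> mat_group Aut_QD"
  "card (rcosets\<^bsub>mat_group Aut_QD\<^esub> super_apollonian) = 48"
proof -
  interpret A: group "mat_group Aut_QD" by (rule group_mat_group[OF subgroup_Aut_QD])
  note H = subgroup_mat_group[OF subgroup_super_apollonian subgroup_Aut_QD super_apollonian_subset]
  have F: "perm_sign_group \<subseteq> carrier (mat_group Aut_QD)" using perm_sign_group_subset by simp
  have inv: "inv\<^bsub>mat_group Aut_QD\<^esub> f = inv\<^bsub>GL4\<^esub> f" if "f \<in> perm_sign_group" for f
    using inv_mat_group[OF subgroup_Aut_QD] that perm_sign_group_subset by blast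
  show "super_apollonian \<lhd> mat_group Aut_QD"
    by (rule A.normal_if_factor_normalizes[OF H F])
      (use Aut_QD_factor perm_sign_group_conj inv in auto)
  have "card (rcosets\<^bsub>mat_group Aut_QD\<^esub> super_apollonian) = card perm_sign_group"
    by (rule A.card_rcosets_transversal[OF H F])
      (use Aut_QD_factor perm_sign_group_uniq inv in auto)
  then show "card (rcosets\<^bsub>mat_group Aut_QD\<^esub> super_apollonian) = 48"
    by (simp add: card_perm_sign_group)
qed

section \<open>The transversal of the super-Apollonian group in \<open>G_grp\<close>\<close>

definition perm_sign_D :: "mat4 set" where
  "perm_sign_D = perm_sign_group \<union> (\<lambda>f. D_mat ** f) ` perm_sign_group"

lemma D_mat_D_mat_mult: "D_mat ** (D_mat ** U) = U"
  by (simp add: matrix_mul_assoc D_mat_squared)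

text \<open>Otherwise multiplying by the inverse of \<open>f\<close> would put \<open>D_mat\<close>
  into \<open>Aut_QD\<close>, but its entries are not integers.\<close>

lemma D_mat_mult_notin_Aut_QD:
  assumes "f \<in> Aut_QD"
  shows "D_mat ** f \<notin> Aut_QD"
proof
  assume "D_mat ** f \<in> Aut_QD"
  then have "(D_mat \<otimes>\<^bsub>GL4\<^esub> f) \<otimes>\<^bsub>GL4\<^esub> inv\<^bsub>GL4\<^esub> f \<in> Aut_QD"
    using subgroup.m_closed[OF subgroup_Aut_QD _ subgroup.m_inv_closed[OF subgroup_Aut_QD assms]] by simp
  moreover have "f \<in> carrier GL4" using assms subgroup.subset[OF subgroup_Aut_QD] by blast
  then have "(D_mat \<otimes>\<^bsub>GL4\<^esub> f) \<otimes>\<^bsub>GL4\<^esub> inv\<^bsub>GL4\<^esub> f = D_mat"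
    using invertible_D_mat GL4.m_assoc[of D_mat f "inv\<^bsub>GL4\<^esub> f"] GL4.inv_closed[of f] GL4.r_inv[of f]
    by simp
  ultimately show False using D_mat_notin_Aut_QD by simp
qed

lemma card_perm_sign_D: "card perm_sign_D = 96"
proof -
  have "inj_on (\<lambda>f. D_mat ** f) perm_sign_group"
    by (rule inj_on_inverseI[of _ "\<lambda>f. D_mat ** f"]) (rule D_mat_D_mat_mult)
  moreover have "perm_sign_group \<inter> (\<lambda>f. D_mat ** f) ` perm_sign_group = {}"
    using D_mat_mult_notin_Aut_QD perm_sign_group_subset by blast
  moreover have "finite perm_sign_group" using card_perm_sign_group card.infinite by fastforce
  ultimately show ?thesis
    unfolding perm_sign_D_def by (simp add: card_Un_disjoint card_image card_perm_sign_group)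
qed

lemma D_mat_commute:
  assumes "f \<in> perm_sign_group"
  shows "D_mat ** f = f ** D_mat"
  using assms
  by (rule perm_sign_group_cases) (simp_all add: D_mat_eq minus_mult mult_minus perm_mat_Q_D)

text \<open>\<open>D_mat\<close> commutes with the finite group, so in the quotient of
  \<open>f\<close> by \<open>g\<close> all its copies move to the front. Two copies cancel and leave
  the case of \<open>perm_sign_group_uniq\<close>; a single copy would give an element outside
  \<open>Aut_QD\<close>, hence outside the super-Apollonian group.\<close>

lemma perm_sign_D_uniq:
  assumes f: "f \<in> perm_sign_D" and g: "g \<in> perm_sign_D"
    and fg: "f \<otimes>\<^bsub>GL4\<^esub> inv\<^bsub>GL4\<^esub> g \<in> super_apollonian"
  shows "f = g"
proof -
  have mem: "a \<otimes>\<^bsub>GL4\<^esub> inv\<^bsub>GL4\<^esub> b \<in> perm_sign_group" if "a \<in> perm_sign_group" "b \<in> perm_sign_group" for a b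
    using subgroup_perm_sign_group that by (intro subgroup.m_closed subgroup.m_inv_closed)
  have invD: "inv\<^bsub>GL4\<^esub> (D_mat ** b) = D_mat ** inv\<^bsub>GL4\<^esub> b" if "b \<in> perm_sign_group" for b
  proof -
    have "b \<in> carrier GL4" using that subgroup.subset[OF subgroup_perm_sign_group] by blast
    then have "b ** inv\<^bsub>GL4\<^esub> b = mat 1" using GL4.r_inv by simp
    then have "(D_mat ** b) ** (D_mat ** inv\<^bsub>GL4\<^esub> b) = mat 1"
      unfolding D_mat_commute[OF that]
      by (metis D_mat_squared matrix_mul_assoc matrix_mul_rid)
    then show ?thesis by (rule inv_GL4)
  qed
  have comm: "a ** (D_mat ** c) = D_mat ** (a ** c)" if "a \<in> perm_sign_group" for a and c :: mat4
    using D_mat_commute[OF that] by (simp add: matrix_mul_assoc)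
  from f consider a where "a \<in> perm_sign_group" "f = a" | a where "a \<in> perm_sign_group" "f = D_mat ** a"
    unfolding perm_sign_D_def by blast
  then show ?thesis
  proof cases
    case f: 1
    from g consider b where "b \<in> perm_sign_group" "g = b" | b where "b \<in> perm_sign_group" "g = D_mat ** b"
      unfolding perm_sign_D_def by blast
    then show ?thesis
    proof cases
      case 1
      then show ?thesis using f fg perm_sign_group_uniq by simp
    next
      case 2
      then have "D_mat ** (a ** inv\<^bsub>GL4\<^esub> b) \<in> super_apollonian" using f fg comm invD by simp
      then show ?thesis
        using D_mat_mult_notin_Aut_QD mem[of a b] f 2 super_apollonian_subset perm_sign_group_subset by auto
    qed
  next
    case f: 2
    from g consider b where "b \<in> perm_sign_group" "g = b" | b where "b \<in> perm_sign_group" "g = D_mat ** b"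
      unfolding perm_sign_D_def by blast
    then show ?thesis
    proof cases
      case 1
      then have "D_mat ** (a ** inv\<^bsub>GL4\<^esub> b) \<in> super_apollonian" using f fg by (simp add: matrix_mul_assoc)
      then show ?thesis
        using D_mat_mult_notin_Aut_QD mem[of a b] f 1 super_apollonian_subset perm_sign_group_subset by auto
    next
      case 2
      then have "D_mat ** (D_mat ** (a ** inv\<^bsub>GL4\<^esub> b)) \<in> super_apollonian"
        using f fg comm invD by (simp add: matrix_mul_assoc[symmetric])
      then show ?thesis using f 2 perm_sign_group_uniq[of a b] by (simp add: D_mat_D_mat_mult)
    qed
  qed
qed

lemma perm_sign_D_subset: "perm_sign_D \<subseteq> G_grp"
  unfolding perm_sign_D_def
  using subgroup.m_closed[OF subgroup_G_grp D_mat_in_G_grp] perm_sign_group_subset Aut_QD_subset_G_grp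
  by auto

lemma G_grp_factor:
  assumes U: "U \<in> G_grp"
  shows "\<exists>h\<in>super_apollonian. \<exists>f\<in>perm_sign_D. U = h ** f"
proof (cases "U \<in> Aut_QD")
  case True
  then show ?thesis using Aut_QD_factor unfolding perm_sign_D_def by blast
next
  case False
  then obtain h f where h: "h \<in> super_apollonian" and f: "f \<in> perm_sign_group" and Df: "D_mat ** U = h ** f"
    using G_grp_cases[OF U] Aut_QD_factor by blast
  have "U = D_mat ** (h ** f)" using D_mat_D_mat_mult[of U] Df by simp
  \<comment> \<open>Inserting \<open>D_mat ** D_mat = mat 1\<close> turns the left factor into a
    conjugate of \<open>h\<close>, which \<open>D_mat_conj\<close> keeps in the super-Apollonian
    group.\<close>
  also have "\<dots> = (D_mat ** h ** D_mat) ** (D_mat ** f)"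
    by (simp add: matrix_mul_assoc[symmetric] D_mat_D_mat_mult)
  finally show ?thesis
    using D_mat_conj[OF h] inv_GL4[OF D_mat_squared] f unfolding perm_sign_D_def by auto
qed

lemma perm_sign_D_conj:
  assumes f: "f \<in> perm_sign_D" and y: "y \<in> super_apollonian"
  shows "f \<otimes>\<^bsub>GL4\<^esub> y \<otimes>\<^bsub>GL4\<^esub> inv\<^bsub>GL4\<^esub> f \<in> super_apollonian"
proof (cases "f \<in> perm_sign_group")
  case True
  then show ?thesis using perm_sign_group_conj y by blast
next
  case False
  then obtain g where g: "g \<in> perm_sign_group" "f = D_mat \<otimes>\<^bsub>GL4\<^esub> g"
    using f unfolding perm_sign_D_def by auto
  have carr: "g \<in> carrier GL4" "y \<in> carrier GL4" "D_mat \<in> carrier GL4"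
    using g(1) y invertible_D_mat subgroup.subset[OF subgroup_perm_sign_group]
      subgroup.subset[OF subgroup_super_apollonian] by auto
  show ?thesis
    unfolding g(2) GL4.conj_mult[OF carr(3,1,2)]
    by (rule D_mat_conj[OF perm_sign_group_conj[OF g(1) y]])
qed

lemma super_apollonian_G_grp:
  "super_apollonian \<lhd> mat_group G_grp"
  "card (rcosets\<^bsub>mat_group G_grp\<^esub> super_apollonian) = 96"
proof -
  interpret G: group "mat_group G_grp" by (rule group_mat_group[OF subgroup_G_grp])
  have "super_apollonian \<subseteq> G_grp" using super_apollonian_subset Aut_QD_subset_G_grp by blast
  note H = subgroup_mat_group[OF subgroup_super_apollonian subgroup_G_grp this]
  have F: "perm_sign_D \<subseteq> carrier (mat_group G_grp)" using perm_sign_D_subset by simp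
  have inv: "inv\<^bsub>mat_group G_grp\<^esub> f = inv\<^bsub>GL4\<^esub> f" if "f \<in> perm_sign_D" for f
    using inv_mat_group[OF subgroup_G_grp] that perm_sign_D_subset by blast
  show "super_apollonian \<lhd> mat_group G_grp"
    by (rule G.normal_if_factor_normalizes[OF H F])
      (use G_grp_factor perm_sign_D_conj inv in auto)
  have "card (rcosets\<^bsub>mat_group G_grp\<^esub> super_apollonian) = card perm_sign_D"
    by (rule G.card_rcosets_transversal[OF H F])
      (use G_grp_factor perm_sign_D_uniq inv in auto)
  then show "card (rcosets\<^bsub>mat_group G_grp\<^esub> super_apollonian) = 96"
    by (simp add: card_perm_sign_D)
qed

section \<open>Generating sets of \<open>Aut_QD\<close> and \<open>G_grp\<close>\<close>

lemma Aut_QD_generated: "Aut_QD = mgen (super_apollonian \<union> perm_sign_group)"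
proof
  show "Aut_QD \<subseteq> mgen (super_apollonian \<union> perm_sign_group)"
  proof
    fix U assume "U \<in> Aut_QD"
    then obtain h f where "h \<in> super_apollonian" "f \<in> perm_sign_group" "U = h ** f"
      using Aut_QD_factor by blast
    then show "U \<in> mgen (super_apollonian \<union> perm_sign_group)"
      by (simp add: mgen_mult mgen_incl)
  qed
  show "mgen (super_apollonian \<union> perm_sign_group) \<subseteq> Aut_QD"
    by (rule mgen_subset[OF _ subgroup_Aut_QD])
      (use super_apollonian_subset perm_sign_group_subset in blast)
qed

lemma G_grp_generated: "G_grp = mgen (Aut_QD \<union> {D_mat})"
proof
  show "G_grp \<subseteq> mgen (Aut_QD \<union> {D_mat})"
  proof
    fix U assume "U \<in> G_grp"
    then have "U \<in> mgen (Aut_QD \<union> {D_mat}) \<or> D_mat ** U \<in> mgen (Aut_QD \<union> {D_mat})"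
      using G_grp_cases mgen_incl by blast
    moreover have "D_mat \<in> mgen (Aut_QD \<union> {D_mat})" by (rule mgen_incl) simp
    ultimately show "U \<in> mgen (Aut_QD \<union> {D_mat})" using mgen_mult D_mat_D_mat_mult[of U] by metis
  qed
  show "mgen (Aut_QD \<union> {D_mat}) \<subseteq> G_grp"
    by (rule mgen_subset[OF _ subgroup_G_grp]) (use Aut_QD_subset_G_grp D_mat_in_G_grp in blast)
qed

theorem theorem7p1:
  shows "super_apollonian \<lhd> mat_group Aut_QD
    \<and> card (rcosets\<^bsub>mat_group Aut_QD\<^esub> super_apollonian) = 48
    \<and> card perm_sign_group = 48
    \<and> Aut_QD = mgen (super_apollonian \<union> perm_sign_group)
    \<and> super_apollonian \<lhd> mat_group G_grp
    \<and> card (rcosets\<^bsub>mat_group G_grp\<^esub> super_apollonian) = 96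
    \<and> G_grp = mgen (Aut_QD \<union> {D_mat})
    \<and> (\<forall>M \<in> G_grp. \<forall>i j. 2 * M$i$j \<in> \<int>)"
  by (intro conjI ballI allI super_apollonian_Aut_QD card_perm_sign_group Aut_QD_generated
      super_apollonian_G_grp G_grp_generated G_grp_half_integral)

end
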